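(* Suppose that $(M,g(t))$ is a steady breather of an abstract geometric flow $\frac{\partial g}{\partial t}=-2\alpha$, i.e. there are a diffeomorphism $\eta\colon M\to M$ and times $t_1<t_2$ such that $g(t_2)=\eta^*g(t_1)$ and $\alpha(t_2)=\eta^*\alpha(t_1)$. Suppose that $\Theta\ge0$ and $B-\Delta A\ge0$. Then $B-\Delta A=0$ and the steady breather is $\alpha$-flat, namely $\alpha=0$ (on $M$, for $t\in[t_1,t_2]$).
   Context: $M$ is a connected compact $n$-dimensional manifold without boundary and $T>0$. An abstract geometric flow is a smooth one-parameter family of Riemannian metrics $g(t)$, $t\in(0,T)$, on $M$ together with a smooth time-dependent symmetric two-tensor $\alpha(t,y)$ on $M$ such that $\frac{\partial g}{\partial t}=-2\alpha$. At time $t$ all geometric objects (inner products, the Levi-Civita connection $\nabla$, the Laplace-Beltrami operator $\Delta$, the Ricci tensor $\mathrm{Rc}$) are taken with respect to $g(t)$. Notation: $A:=g^{ij}\alpha_{ij}$, $\beta_{ij}:=\frac{\partial\alpha_{ij}}{\partial t}$, $B:=g^{ij}\beta_{ij}$, and $\mathrm{Div}(\alpha)_k=g^{ij}\nabla_i\alpha_{jk}$. For any time-dependent vector field $V$ on $M$, $$\Theta(V):=(\mathrm{Rc}-\alpha)(V,V)+\langle\nabla A-2\,\mathrm{Div}(\alpha),V\rangle+\tfrac12(B-\Delta A).$$ $\Theta\ge0$ means $\Theta(V)\ge 0$ for all $V$. A solution $(M,g(t))$ is called a breather if there are a diffeomorphism $\eta\colon M\to M$, a positive constant $c$ and times $t_1<t_2$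 such that $g(t_2)=c\,\eta^*g(t_1)$ and $\alpha(t_2)=\eta^*\alpha(t_1)$; it is steady when $c=1$. *)

theory Defs
  imports "HOL-Analysis.Analysis"
begin

text \<open>
  Smooth functions on an open subset \<open>S\<close> of a normed space; the definitions are only used for open
  \<open>S\<close>.  In finite dimension, \<open>C\<^sup>k\<^sup>+\<^sup>1\<close> means differentiable with all directional derivatives \<open>C\<^sup>k\<close>.
\<close>

primrec Ck_on ::
  "nat \<Rightarrow> 'a::real_normed_vector set \<Rightarrow> ('a \<Rightarrow> 'b::real_normed_vector) \<Rightarrow> bool" where
  "Ck_on 0 S f \<longleftrightarrow> continuous_on S f"
| "Ck_on (Suc k) S f \<longleftrightarrow>
     (\<forall>x\<in>S. f differentiable (at x)) \<and>
     (\<forall>v. Ck_on k S (\<lambda>x. frechet_derivative f (at x) v))"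

definition smooth_on ::
  "'a::real_normed_vector set \<Rightarrow> ('a \<Rightarrow> 'b::real_normed_vector) \<Rightarrow> bool" where
  "smooth_on S f \<longleftrightarrow> (\<forall>k. Ck_on k S f)"


section \<open>Smooth manifolds\<close>

text \<open>
  A chart is a domain together with a coordinate map, whose values off the domain are irrelevant.
  The index type \<open>'n\<close> plays the role of \<open>{1, \<dots>, n}\<close>.
\<close>

type_synonym ('a, 'n) chart = "'a set \<times> ('a \<Rightarrow> real^'n)"

abbreviation chart_dom :: "('a, 'n::finite) chart \<Rightarrow> 'a set" where
  "chart_dom \<kappa> \<equiv> fst \<kappa>"

abbreviation chart_map :: "('a, 'n::finite) chart \<Rightarrow> 'a \<Rightarrow> real^'n" where
  "chart_map \<kappa> \<equiv> snd \<kappa>"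

definition chart_inv :: "('a, 'n::finite) chart \<Rightarrow> real^'n \<Rightarrow> 'a" where
  "chart_inv \<kappa> = inv_into (chart_dom \<kappa>) (chart_map \<kappa>)"

definition is_chart :: "'a topology \<Rightarrow> ('a, 'n::finite) chart \<Rightarrow> bool" where
  "is_chart X \<kappa> \<longleftrightarrow>
     openin X (chart_dom \<kappa>) \<and> open (chart_map \<kappa> ` chart_dom \<kappa>) \<and>
     homeomorphic_map (subtopology X (chart_dom \<kappa>))
       (top_of_set (chart_map \<kappa> ` chart_dom \<kappa>)) (chart_map \<kappa>)"

definition smooth_map :: "('a, 'n::finite) chart set \<Rightarrow> ('a \<Rightarrow> 'a) \<Rightarrow> bool" where
  "smooth_map \<A> f \<longleftrightarrow>
     (\<forall>\<kappa>\<in>\<A>. \<forall>\<kappa>'\<in>\<A>.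
        smooth_on (chart_map \<kappa> ` {p \<in> chart_dom \<kappa>. f p \<in> chart_dom \<kappa>'})
          (chart_map \<kappa>' \<circ> f \<circ> chart_inv \<kappa>))"

text \<open>
  An \<open>n\<close>-dimensional smooth manifold without boundary, given by an atlas that need not be maximal.
  Smoothness of the identity says exactly that all transition maps are smooth.  Second countability
  is automatic in the compact case, the only one considered.
\<close>

definition smooth_manifold :: "'a topology \<Rightarrow> ('a, 'n::finite) chart set \<Rightarrow> bool" where
  "smooth_manifold X \<A> \<longleftrightarrow>
     Hausdorff_space X \<and> (\<forall>\<kappa>\<in>\<A>. is_chart X \<kappa>) \<and> (\<Union>\<kappa>\<in>\<A>. chart_dom \<kappa>) = topspace X \<and>
     smooth_map \<A> id"

definition diffeomorphism ::
  "'a topology \<Rightarrow> ('a, 'n::finite) chart set \<Rightarrow> ('a \<Rightarrow> 'a) \<Rightarrow> bool" where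
  "diffeomorphism X \<A> f \<longleftrightarrow>
     (\<exists>f'. homeomorphic_maps X X f f' \<and> smooth_map \<A> f \<and> smooth_map \<A> f')"

text \<open>The Jacobian matrix at \<open>p\<close> of \<open>f\<close>, read in the chart \<open>\<kappa>\<close> around \<open>p\<close> and \<open>\<kappa>'\<close> around \<open>f p\<close>.\<close>

definition chart_jac ::
  "('a, 'n::finite) chart \<Rightarrow> ('a, 'n) chart \<Rightarrow> ('a \<Rightarrow> 'a) \<Rightarrow> 'a \<Rightarrow> real^'n^'n" where
  "chart_jac \<kappa> \<kappa>' f p =
     matrix (frechet_derivative (chart_map \<kappa>' \<circ> f \<circ> chart_inv \<kappa>) (at (chart_map \<kappa> p)))"


section \<open>Tensor fields\<close>

text \<open>
  A covariant two-tensor field is the family of its component matrices \<open>h\<^sub>i\<^sub>j\<close> in the charts,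
  subject to the transformation law; a vector field likewise.  The components in a chart are
  meaningful only on the domain of that chart.
\<close>

type_synonym ('a, 'n) tensor2 = "('a, 'n) chart \<Rightarrow> 'a \<Rightarrow> real^'n^'n"
type_synonym ('a, 'n) vfield = "('a, 'n) chart \<Rightarrow> 'a \<Rightarrow> real^'n"

text \<open>
  Components in \<open>\<kappa>\<close> of the pullback of \<open>h\<close> under \<open>f\<close>, computed from the components of \<open>h\<close> in a
  chart \<open>\<kappa>'\<close> around \<open>f p\<close>; for a tensor field \<open>h\<close> the result does not depend on \<open>\<kappa>'\<close>.
\<close>

definition pullback ::
  "('a \<Rightarrow> 'a) \<Rightarrow> ('a, 'n::finite) tensor2 \<Rightarrow> ('a, 'n) chart \<Rightarrow> ('a, 'n) chart \<Rightarrow> 'a \<Rightarrow> real^'n^'n"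
  where
  "pullback f h \<kappa>' \<kappa> p =
     transpose (chart_jac \<kappa> \<kappa>' f p) ** h \<kappa>' (f p) ** chart_jac \<kappa> \<kappa>' f p"

definition sym_tensor_field ::
  "('a, 'n::finite) chart set \<Rightarrow> ('a, 'n) tensor2 \<Rightarrow> bool" where
  "sym_tensor_field \<A> h \<longleftrightarrow>
     (\<forall>\<kappa>\<in>\<A>. \<forall>p\<in>chart_dom \<kappa>. transpose (h \<kappa> p) = h \<kappa> p) \<and>
     (\<forall>\<kappa>\<in>\<A>. \<forall>\<kappa>'\<in>\<A>. \<forall>p\<in>chart_dom \<kappa> \<inter> chart_dom \<kappa>'. h \<kappa> p = pullback id h \<kappa>' \<kappa> p)"

definition vector_field ::
  "('a, 'n::finite) chart set \<Rightarrow> ('a, 'n) vfield \<Rightarrow> bool" where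
  "vector_field \<A> V \<longleftrightarrow>
     (\<forall>\<kappa>\<in>\<A>. \<forall>\<kappa>'\<in>\<A>. \<forall>p\<in>chart_dom \<kappa> \<inter> chart_dom \<kappa>'.
        V \<kappa>' p = chart_jac \<kappa> \<kappa>' id p *v V \<kappa> p)"

text \<open>Joint smoothness in time and space of a time-dependent family of components.\<close>

definition smooth_family ::
  "('a, 'n::finite) chart set \<Rightarrow> real \<Rightarrow>
   (real \<Rightarrow> ('a, 'n) chart \<Rightarrow> 'a \<Rightarrow> 'b::real_normed_vector) \<Rightarrow> bool" where
  "smooth_family \<A> T h \<longleftrightarrow>
     (\<forall>\<kappa>\<in>\<A>. smooth_on ({0<..<T} \<times> chart_map \<kappa> ` chart_dom \<kappa>)
               (\<lambda>(t, x). h t \<kappa> (chart_inv \<kappa> x)))"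

definition time_dep_vector_field ::
  "('a, 'n::finite) chart set \<Rightarrow> real \<Rightarrow> (real \<Rightarrow> ('a, 'n) vfield) \<Rightarrow> bool" where
  "time_dep_vector_field \<A> T V \<longleftrightarrow>
     (\<forall>t\<in>{0<..<T}. vector_field \<A> (V t)) \<and> smooth_family \<A> T V"


section \<open>Riemannian geometry in charts\<close>

text \<open>
  Throughout, \<open>G\<close> is the family of components of a metric.  Scalar fields produced from \<open>G\<close> and
  other tensors by index formulas carry the chart they are computed in as an argument, although
  their value does not depend on it.
\<close>

definition pd :: "('a, 'n::finite) chart \<Rightarrow> 'n \<Rightarrow> ('a \<Rightarrow> real) \<Rightarrow> 'a \<Rightarrow> real" where
  "pd \<kappa> i f p = frechet_derivative (f \<circ> chart_inv \<kappa>) (at (chart_map \<kappa> p)) (axis i 1)"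

definition riemannian_metric ::
  "('a, 'n::finite) chart set \<Rightarrow> ('a, 'n) tensor2 \<Rightarrow> bool" where
  "riemannian_metric \<A> G \<longleftrightarrow>
     sym_tensor_field \<A> G \<and>
     (\<forall>\<kappa>\<in>\<A>. \<forall>p\<in>chart_dom \<kappa>. \<forall>v. v \<noteq> 0 \<longrightarrow> 0 < v \<bullet> (G \<kappa> p *v v))"

definition metric_inner ::
  "('a, 'n::finite) tensor2 \<Rightarrow> ('a, 'n) chart \<Rightarrow> 'a \<Rightarrow> real^'n \<Rightarrow> real^'n \<Rightarrow> real" where
  "metric_inner G \<kappa> p v w = (\<Sum>i\<in>UNIV. \<Sum>j\<in>UNIV. G \<kappa> p $ i $ j * v $ i * w $ j)"

definition ginv :: "('a, 'n::finite) tensor2 \<Rightarrow> ('a, 'n) chart \<Rightarrow> 'n \<Rightarrow> 'n \<Rightarrow> 'a \<Rightarrow> real" where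
  "ginv G \<kappa> i j p = matrix_inv (G \<kappa> p) $ i $ j"

text \<open>The vector metrically dual to a covector \<open>\<omega>\<close>.\<close>

definition sharp ::
  "('a, 'n::finite) tensor2 \<Rightarrow> ('a, 'n) chart \<Rightarrow> 'a \<Rightarrow> ('n \<Rightarrow> real) \<Rightarrow> real^'n" where
  "sharp G \<kappa> p \<omega> = (\<chi> i. \<Sum>j\<in>UNIV. ginv G \<kappa> i j p * \<omega> j)"

definition metric_trace ::
  "('a, 'n::finite) tensor2 \<Rightarrow> ('a, 'n) tensor2 \<Rightarrow> ('a, 'n) chart \<Rightarrow> 'a \<Rightarrow> real" where
  "metric_trace G h \<kappa> p = (\<Sum>i\<in>UNIV. \<Sum>j\<in>UNIV. ginv G \<kappa> i j p * h \<kappa> p $ i $ j)"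

text \<open>\<open>christoffel G \<kappa> k i j\<close> is \<open>\<Gamma>\<^sup>k\<^sub>i\<^sub>j\<close>.\<close>

definition christoffel ::
  "('a, 'n::finite) tensor2 \<Rightarrow> ('a, 'n) chart \<Rightarrow> 'n \<Rightarrow> 'n \<Rightarrow> 'n \<Rightarrow> 'a \<Rightarrow> real" where
  "christoffel G \<kappa> k i j p =
     (1/2) * (\<Sum>l\<in>UNIV. ginv G \<kappa> k l p *
        (pd \<kappa> i (\<lambda>q. G \<kappa> q $ j $ l) p + pd \<kappa> j (\<lambda>q. G \<kappa> q $ i $ l) p
         - pd \<kappa> l (\<lambda>q. G \<kappa> q $ i $ j) p))"

text \<open>
  \<open>R\<^sub>i\<^sub>j = \<partial>\<^sub>k \<Gamma>\<^sup>k\<^sub>i\<^sub>j - \<partial>\<^sub>j \<Gamma>\<^sup>k\<^sub>i\<^sub>k + \<Gamma>\<^sup>k\<^sub>k\<^sub>l \<Gamma>\<^sup>l\<^sub>i\<^sub>j - \<Gamma>\<^sup>k\<^sub>j\<^sub>l \<Gamma>\<^sup>l\<^sub>i\<^sub>k\<close>,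
  with the sign that makes round spheres positive.
\<close>

definition ricci :: "('a, 'n::finite) tensor2 \<Rightarrow> ('a, 'n) tensor2" where
  "ricci G \<kappa> p = (\<chi> i j.
     (\<Sum>k\<in>UNIV. pd \<kappa> k (christoffel G \<kappa> k i j) p - pd \<kappa> j (christoffel G \<kappa> k i k) p) +
     (\<Sum>k\<in>UNIV. \<Sum>l\<in>UNIV.
        christoffel G \<kappa> k k l p * christoffel G \<kappa> l i j p
        - christoffel G \<kappa> k j l p * christoffel G \<kappa> l i k p))"

definition gradient ::
  "('a, 'n::finite) tensor2 \<Rightarrow> (('a, 'n) chart \<Rightarrow> 'a \<Rightarrow> real) \<Rightarrow> ('a, 'n) chart \<Rightarrow> 'a \<Rightarrow> real^'n" where
  "gradient G f \<kappa> p = sharp G \<kappa> p (\<lambda>j. pd \<kappa> j (f \<kappa>) p)"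

text \<open>\<open>\<Delta>f = g\<^sup>i\<^sup>j \<nabla>\<^sub>i \<nabla>\<^sub>j f\<close>.\<close>

definition laplacian ::
  "('a, 'n::finite) tensor2 \<Rightarrow> (('a, 'n) chart \<Rightarrow> 'a \<Rightarrow> real) \<Rightarrow> ('a, 'n) chart \<Rightarrow> 'a \<Rightarrow> real" where
  "laplacian G f \<kappa> p =
     (\<Sum>i\<in>UNIV. \<Sum>j\<in>UNIV. ginv G \<kappa> i j p *
        (pd \<kappa> i (pd \<kappa> j (f \<kappa>)) p
         - (\<Sum>k\<in>UNIV. christoffel G \<kappa> k i j p * pd \<kappa> k (f \<kappa>) p)))"

text \<open>\<open>cov_deriv G h \<kappa> i j k\<close> is \<open>\<nabla>\<^sub>i h\<^sub>j\<^sub>k\<close>.\<close>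

definition cov_deriv ::
  "('a, 'n::finite) tensor2 \<Rightarrow> ('a, 'n) tensor2 \<Rightarrow> ('a, 'n) chart \<Rightarrow> 'n \<Rightarrow> 'n \<Rightarrow> 'n \<Rightarrow> 'a \<Rightarrow> real" where
  "cov_deriv G h \<kappa> i j k p =
     pd \<kappa> i (\<lambda>q. h \<kappa> q $ j $ k) p
     - (\<Sum>l\<in>UNIV. christoffel G \<kappa> l i j p * h \<kappa> p $ l $ k)
     - (\<Sum>l\<in>UNIV. christoffel G \<kappa> l i k p * h \<kappa> p $ j $ l)"

definition divergence ::
  "('a, 'n::finite) tensor2 \<Rightarrow> ('a, 'n) tensor2 \<Rightarrow> ('a, 'n) chart \<Rightarrow> 'n \<Rightarrow> 'a \<Rightarrow> real" where
  "divergence G h \<kappa> k p = (\<Sum>i\<in>UNIV. \<Sum>j\<in>UNIV. ginv G \<kappa> i j p * cov_deriv G h \<kappa> i j k p)"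


section \<open>Abstract geometric flows\<close>

definition geometric_flow ::
  "('a, 'n::finite) chart set \<Rightarrow> real \<Rightarrow>
   (real \<Rightarrow> ('a, 'n) tensor2) \<Rightarrow> (real \<Rightarrow> ('a, 'n) tensor2) \<Rightarrow> bool" where
  "geometric_flow \<A> T g \<alpha> \<longleftrightarrow>
     (\<forall>t\<in>{0<..<T}. riemannian_metric \<A> (g t)) \<and> smooth_family \<A> T g \<and>
     (\<forall>t\<in>{0<..<T}. sym_tensor_field \<A> (\<alpha> t)) \<and> smooth_family \<A> T \<alpha> \<and>
     (\<forall>t\<in>{0<..<T}. \<forall>\<kappa>\<in>\<A>. \<forall>p\<in>chart_dom \<kappa>.
        ((\<lambda>s. g s \<kappa> p) has_vector_derivative (-2) *\<^sub>R \<alpha> t \<kappa> p) (at t))"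

definition time_deriv ::
  "(real \<Rightarrow> ('a, 'n::finite) tensor2) \<Rightarrow> real \<Rightarrow> ('a, 'n) tensor2" where
  "time_deriv h t \<kappa> p = vector_derivative (\<lambda>s. h s \<kappa> p) (at t)"

definition flow_A ::
  "(real \<Rightarrow> ('a, 'n::finite) tensor2) \<Rightarrow> (real \<Rightarrow> ('a, 'n) tensor2) \<Rightarrow>
   real \<Rightarrow> ('a, 'n) chart \<Rightarrow> 'a \<Rightarrow> real" where
  "flow_A g \<alpha> t = metric_trace (g t) (\<alpha> t)"

definition flow_B ::
  "(real \<Rightarrow> ('a, 'n::finite) tensor2) \<Rightarrow> (real \<Rightarrow> ('a, 'n) tensor2) \<Rightarrow>
   real \<Rightarrow> ('a, 'n) chart \<Rightarrow> 'a \<Rightarrow> real" where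
  "flow_B g \<alpha> t = metric_trace (g t) (time_deriv \<alpha> t)"

definition B_minus_Lap_A ::
  "(real \<Rightarrow> ('a, 'n::finite) tensor2) \<Rightarrow> (real \<Rightarrow> ('a, 'n) tensor2) \<Rightarrow>
   real \<Rightarrow> ('a, 'n) chart \<Rightarrow> 'a \<Rightarrow> real" where
  "B_minus_Lap_A g \<alpha> t \<kappa> p = flow_B g \<alpha> t \<kappa> p - laplacian (g t) (flow_A g \<alpha> t) \<kappa> p"

definition Theta ::
  "(real \<Rightarrow> ('a, 'n::finite) tensor2) \<Rightarrow> (real \<Rightarrow> ('a, 'n) tensor2) \<Rightarrow> (real \<Rightarrow> ('a, 'n) vfield) \<Rightarrow>
   real \<Rightarrow> ('a, 'n) chart \<Rightarrow> 'a \<Rightarrow> real" where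
  "Theta g \<alpha> V t \<kappa> p =
     (\<Sum>i\<in>UNIV. \<Sum>j\<in>UNIV.
        (ricci (g t) \<kappa> p $ i $ j - \<alpha> t \<kappa> p $ i $ j) * V t \<kappa> p $ i * V t \<kappa> p $ j)
     + metric_inner (g t) \<kappa> p
         (gradient (g t) (flow_A g \<alpha> t) \<kappa> p
          - 2 *\<^sub>R sharp (g t) \<kappa> p (\<lambda>k. divergence (g t) (\<alpha> t) \<kappa> k p))
         (V t \<kappa> p)
     + (1/2) * B_minus_Lap_A g \<alpha> t \<kappa> p"

definition Theta_nonneg ::
  "('a, 'n::finite) chart set \<Rightarrow> real \<Rightarrow>
   (real \<Rightarrow> ('a, 'n) tensor2) \<Rightarrow> (real \<Rightarrow> ('a, 'n) tensor2) \<Rightarrow> bool" where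
  "Theta_nonneg \<A> T g \<alpha> \<longleftrightarrow>
     (\<forall>V. time_dep_vector_field \<A> T V \<longrightarrow>
        (\<forall>t\<in>{0<..<T}. \<forall>\<kappa>\<in>\<A>. \<forall>p\<in>chart_dom \<kappa>. 0 \<le> Theta g \<alpha> V t \<kappa> p))"

definition breather ::
  "'a topology \<Rightarrow> ('a, 'n::finite) chart set \<Rightarrow> real \<Rightarrow>
   (real \<Rightarrow> ('a, 'n) tensor2) \<Rightarrow> (real \<Rightarrow> ('a, 'n) tensor2) \<Rightarrow>
   ('a \<Rightarrow> 'a) \<Rightarrow> real \<Rightarrow> real \<Rightarrow> real \<Rightarrow> bool" where
  "breather X \<A> T g \<alpha> \<eta> c t1 t2 \<longleftrightarrow>
     diffeomorphism X \<A> \<eta> \<and> 0 < c \<and> 0 < t1 \<and> t1 < t2 \<and> t2 < T \<and>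
     (\<forall>\<kappa>\<in>\<A>. \<forall>\<kappa>'\<in>\<A>. \<forall>p\<in>chart_dom \<kappa>. \<eta> p \<in> chart_dom \<kappa>' \<longrightarrow>
        g t2 \<kappa> p = c *\<^sub>R pullback \<eta> (g t1) \<kappa>' \<kappa> p \<and>
        \<alpha> t2 \<kappa> p = pullback \<eta> (\<alpha> t1) \<kappa>' \<kappa> p)"

abbreviation steady_breather ::
  "'a topology \<Rightarrow> ('a, 'n::finite) chart set \<Rightarrow> real \<Rightarrow>
   (real \<Rightarrow> ('a, 'n) tensor2) \<Rightarrow> (real \<Rightarrow> ('a, 'n) tensor2) \<Rightarrow>
   ('a \<Rightarrow> 'a) \<Rightarrow> real \<Rightarrow> real \<Rightarrow> bool" where
  "steady_breather X \<A> T g \<alpha> \<eta> t1 t2 \<equiv> breather X \<A> T g \<alpha> \<eta> 1 t1 t2"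

end

theory Submission
  imports Defs
begin

text \<open>
  The trace \<open>A\<close> satisfies \<open>\<partial>A/\<partial>t = B + 2 |\<alpha>|\<^sup>2 = \<Delta>A + (B - \<Delta>A) + 2 |\<alpha>|\<^sup>2\<close>, so \<open>B - \<Delta>A \<ge> 0\<close> makes it a
  supersolution of the heat equation of \<open>g(t)\<close>.  Let \<open>m\<close> be the minimum of \<open>A\<close> on \<open>M \<times> [t1, t2]\<close>.  By the
  strong minimum principle on the connected \<open>M\<close>, once \<open>A > m\<close> holds at one point it holds
  everywhere at all later times.  Since \<open>A(t2) = A(t1) \<circ> \<eta>\<close>, the value \<open>m\<close> is also attained at time
  \<open>t2\<close>; hence \<open>A\<close> is constant on \<open>M \<times> [t1, t2]\<close>, and the evolution equation becomes
  \<open>0 = (B - \<Delta>A) + 2 |\<alpha>|\<^sup>2\<close>, a sum of two nonnegative terms.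
\<close>

section \<open>Closure properties of \<open>C\<^sup>k\<close> functions\<close>

text \<open>The analysis takes place in a fixed chart. There the metric is jointly smooth in time
  and space, and so is its inverse, so \<open>A\<close> becomes a smooth function of
  \<open>(t, x)\<close> satisfying a linear parabolic inequality with continuous elliptic
  coefficients. That \<open>A \<ge> m\<close> holds by the choice of \<open>m\<close>; the obstacle
  is to make a strict inequality travel sideways from a single point. An explicit barrier with
  growing support does this inside a chart, in arbitrarily short time, so a clopen argument carries
  it over the manifold without losing time. Strictness propagates only forward, so a point where
  \<open>m\<close> is attained says something only about earlier times. This is why the minimum has
  to be brought to the final time: an excess at time \<open>t1\<close> over the minimum point would
  survive until the minimum is attained, so \<open>m\<close> is already attained at
  \<open>t1\<close>, and the inverse of \<eta> moves that point to time \<open>t2\<close>.\<close>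

lemma Ck_on_cong:
  assumes "open S" and "\<And>x. x \<in> S \<Longrightarrow> f x = g x" and "Ck_on k S f"
  shows "Ck_on k S g"
  using assms(2,3)
proof (induction k arbitrary: f g)
  case 0
  then show ?case by (simp cong: continuous_on_cong)
next
  case (Suc k)
  have D: "(g has_derivative frechet_derivative f (at x)) (at x)" if "x \<in> S" for x
  proof -
    have "(f has_derivative frechet_derivative f (at x)) (at x)"
      using Suc.prems(2) that by (simp add: frechet_derivative_works)
    then show ?thesis
      using has_derivative_transform_within_open[OF _ assms(1) that] Suc.prems(1) by blast
  qed
  then have E: "frechet_derivative g (at x) = frechet_derivative f (at x)" if "x \<in> S" for x
    using that by (metis frechet_derivative_at)
  show ?case
    unfolding Ck_on.simps
  proof (intro conjI ballI allI)
    show "g differentiable at x" if "x \<in> S" for x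
      using D[OF that] by (rule differentiableI)
    show "Ck_on k S (\<lambda>x. frechet_derivative g (at x) v)" for v
      using Suc.IH[of "\<lambda>x. frechet_derivative f (at x) v"] Suc.prems(2) E by simp
  qed
qed

text \<open>Derivatives at points of an open set are unique, so an explicit formula \<open>D\<close>
  may replace the chosen \<open>frechet_derivative\<close>. The closure properties that follow use
  this form to apply their induction hypotheses to \<open>D\<close>.\<close>

lemma Ck_on_SucI:
  assumes "open S" and "\<And>x. x \<in> S \<Longrightarrow> (f has_derivative D x) (at x)"
    and "\<And>v. Ck_on k S (\<lambda>x. D x v)"
  shows "Ck_on (Suc k) S f"
proof -
  have "frechet_derivative f (at x) = D x" if "x \<in> S" for x
    using assms(2)[OF that] by (metis frechet_derivative_at)
  then have "Ck_on k S (\<lambda>x. frechet_derivative f (at x) v)" for v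
    using Ck_on_cong[OF assms(1) _ assms(3)[of v]] by auto
  then show ?thesis using assms(2) by (auto intro: differentiableI)
qed

lemma Ck_on_SucD:
  assumes "Ck_on (Suc k) S f"
  shows "\<And>x. x \<in> S \<Longrightarrow> (f has_derivative frechet_derivative f (at x)) (at x)"
    and "\<And>v. Ck_on k S (\<lambda>x. frechet_derivative f (at x) v)"
  using assms by (auto simp: frechet_derivative_works)

text \<open>The recursive definition does not contain the lower orders. They are needed because
  product and quotient rules leave undifferentiated factors behind.\<close>

lemma Ck_on_lower:
  assumes "Ck_on (Suc k) S f"
  shows "Ck_on k S f"
  using assms
proof (induction k arbitrary: f)
  case 0
  then show ?case
    by (auto intro!: continuous_at_imp_continuous_on differentiable_imp_continuous_within)
next
  case (Suc k)
  then show ?case by (metis Ck_on.simps(2))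
qed

lemma Ck_on_const:
  assumes "open S"
  shows "Ck_on k S (\<lambda>x. c)"
proof (induction k arbitrary: c)
  case (Suc k)
  show ?case
    by (rule Ck_on_SucI[OF assms, where D = "\<lambda>x v. 0"]) (simp_all add: Suc)
qed simp

lemma Ck_on_add:
  assumes "open S" and "Ck_on k S f" and "Ck_on k S g"
  shows "Ck_on k S (\<lambda>x. f x + g x)"
  using assms(2,3)
proof (induction k arbitrary: f g)
  case 0
  then show ?case by (simp add: continuous_on_add)
next
  case (Suc k)
  show ?case
  proof (rule Ck_on_SucI[OF assms(1)])
    show "((\<lambda>x. f x + g x) has_derivative
        (\<lambda>v. frechet_derivative f (at x) v + frechet_derivative g (at x) v)) (at x)"
      if "x \<in> S" for x
      using Suc.prems Ck_on_SucD(1) that by (blast intro: has_derivative_add)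
    show "Ck_on k S (\<lambda>x. frechet_derivative f (at x) v + frechet_derivative g (at x) v)" for v
      using Suc.prems by (intro Suc.IH) auto
  qed
qed

lemma Ck_on_mult:
  fixes f g :: "'a::real_normed_vector \<Rightarrow> real"
  assumes "open S" and "Ck_on k S f" and "Ck_on k S g"
  shows "Ck_on k S (\<lambda>x. f x * g x)"
  using assms(2,3)
proof (induction k arbitrary: f g)
  case 0
  then show ?case by (simp add: continuous_on_mult)
next
  case (Suc k)
  show ?case
  proof (rule Ck_on_SucI[OF assms(1)])
    show "((\<lambda>x. f x * g x) has_derivative
        (\<lambda>v. f x * frechet_derivative g (at x) v + frechet_derivative f (at x) v * g x)) (at x)"
      if "x \<in> S" for x
      using Suc.prems Ck_on_SucD(1) that by (blast intro: has_derivative_mult)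
    show "Ck_on k S (\<lambda>x. f x * frechet_derivative g (at x) v + frechet_derivative f (at x) v * g x)"
      for v
      using Suc.prems Ck_on_lower[OF Suc.prems(1)] Ck_on_lower[OF Suc.prems(2)]
      by (intro Ck_on_add[OF assms(1)] Suc.IH) auto
  qed
qed

text \<open>The derivative of \<open>1/f\<close> contains \<open>1/f\<close> itself, so the
  induction keeps \<open>f\<close> fixed and takes this factor from the induction
  hypothesis.\<close>

lemma Ck_on_inverse:
  fixes f :: "'a::real_normed_vector \<Rightarrow> real"
  assumes "open S" and "Ck_on k S f" and nz: "\<And>x. x \<in> S \<Longrightarrow> f x \<noteq> 0"
  shows "Ck_on k S (\<lambda>x. inverse (f x))"
  using assms(2)
proof (induction k)
  case 0
  then show ?case using nz by (simp add: continuous_on_inverse)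
next
  case (Suc k)
  have inv: "Ck_on k S (\<lambda>x. inverse (f x))"
    using Suc Ck_on_lower by blast
  show ?case
  proof (rule Ck_on_SucI[OF assms(1)])
    show "((\<lambda>x. inverse (f x)) has_derivative
        (\<lambda>v. (-1) * (inverse (f x) * frechet_derivative f (at x) v * inverse (f x)))) (at x)"
      if "x \<in> S" for x
      using Deriv.has_derivative_inverse[OF nz[OF that] Ck_on_SucD(1)[OF Suc.prems that]] by simp
    show "Ck_on k S (\<lambda>x. (-1) * (inverse (f x) * frechet_derivative f (at x) v * inverse (f x)))" for v
      using inv Ck_on_SucD(2)[OF Suc.prems] assms(1)
      by (intro Ck_on_mult Ck_on_const) auto
  qed
qed

lemma Ck_on_sum:
  assumes "open S" and "\<And>i. i \<in> I \<Longrightarrow> Ck_on k S (f i)"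
  shows "Ck_on k S (\<lambda>x. \<Sum>i\<in>I. f i x)"
  using assms(2)
  by (induction I rule: infinite_finite_induct) (auto intro: Ck_on_const Ck_on_add assms(1))

lemma Ck_on_prod:
  fixes f :: "'i \<Rightarrow> 'a::real_normed_vector \<Rightarrow> real"
  assumes "open S" and "\<And>i. i \<in> I \<Longrightarrow> Ck_on k S (f i)"
  shows "Ck_on k S (\<lambda>x. \<Prod>i\<in>I. f i x)"
  using assms(2)
  by (induction I rule: infinite_finite_induct) (auto intro: Ck_on_const Ck_on_mult assms(1))

lemma Ck_on_bounded_linear:
  assumes "open S" and "bounded_linear L" and "Ck_on k S f"
  shows "Ck_on k S (\<lambda>x. L (f x))"
  using assms(3)
proof (induction k arbitrary: f)
  case 0
  then show ?case by (simp add: bounded_linear.continuous_on[OF assms(2)])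
next
  case (Suc k)
  show ?case
  proof (rule Ck_on_SucI[OF assms(1)])
    show "((\<lambda>x. L (f x)) has_derivative (\<lambda>v. L (frechet_derivative f (at x) v))) (at x)"
      if "x \<in> S" for x
      using bounded_linear.has_derivative[OF assms(2)] Ck_on_SucD(1)[OF Suc.prems that] by blast
    show "Ck_on k S (\<lambda>x. L (frechet_derivative f (at x) v))" for v
      using Suc by auto
  qed
qed

section \<open>Smooth dependence of determinants and inverse matrices on their entries\<close>

lemma Ck_on_matrix_entry:
  fixes M :: "'a::real_normed_vector \<Rightarrow> real^'n^'m"
  assumes "open S" and "Ck_on k S M"
  shows "Ck_on k S (\<lambda>x. M x $ i $ j)"
  using Ck_on_bounded_linear[OF assms(1) bounded_linear_compose[OF bounded_linear_vec_nth bounded_linear_vec_nth] assms(2)]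
  by simp

lemma Ck_on_det:
  fixes M :: "'a::real_normed_vector \<Rightarrow> real^'n^'n"
  assumes "open S" and "\<And>i j. Ck_on k S (\<lambda>x. M x $ i $ j)"
  shows "Ck_on k S (\<lambda>x. det (M x))"
  unfolding det_def
  using assms by (intro Ck_on_sum Ck_on_mult Ck_on_const Ck_on_prod) auto

lemma invertible_matrix_inv:
  fixes M :: "real^'n^'n"
  assumes "invertible M"
  shows "M ** matrix_inv M = mat 1" and "matrix_inv M ** M = mat 1"
proof -
  have "M ** matrix_inv M = mat 1 \<and> matrix_inv M ** M = mat 1"
    using assms unfolding invertible_def matrix_inv_def by (rule someI_ex)
  then show "M ** matrix_inv M = mat 1" and "matrix_inv M ** M = mat 1" by auto
qed

text \<open>Cramer's rule for the columns of the inverse. It exhibits each entry as a polynomial in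
  the entries of \<open>M\<close> divided by \<open>det M\<close>, which is the form from which
  smoothness of the inverse metric is read off.\<close>

lemma matrix_inv_entry:
  fixes M :: "real^'n^'n"
  assumes "invertible M"
  shows "matrix_inv M $ i $ j =
    det (\<chi> r c. if c = i then (if r = j then 1 else 0) else M $ r $ c) * inverse (det M)"
proof -
  have "M *v (matrix_inv M *v axis j 1) = axis j 1"
    by (simp add: matrix_vector_mul_assoc invertible_matrix_inv[OF assms])
  then have "matrix_inv M *v axis j 1 =
    (\<chi> k. det (\<chi> r c. if c = k then axis j 1 $ r else M $ r $ c) / det M)"
    using cramer[of M] assms invertible_det_nz by blast
  moreover have "(matrix_inv M *v axis j 1) $ i = matrix_inv M $ i $ j"
    by (simp add: matrix_vector_mult_basis column_def)
  ultimately show ?thesis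
    by (simp add: axis_def divide_inverse eq_commute cong: if_cong)
qed

lemma Ck_on_matrix_inv:
  fixes M :: "'a::real_normed_vector \<Rightarrow> real^'n^'n"
  assumes "open S" and "\<And>i j. Ck_on k S (\<lambda>x. M x $ i $ j)"
    and inv: "\<And>x. x \<in> S \<Longrightarrow> invertible (M x)"
  shows "Ck_on k S (\<lambda>x. matrix_inv (M x) $ i $ j)"
proof (rule Ck_on_cong[OF assms(1)])
  show "Ck_on k S (\<lambda>x. det (\<chi> r c. if c = i then (if r = j then 1 else 0) else M x $ r $ c)
      * inverse (det (M x)))"
  proof (intro Ck_on_mult Ck_on_inverse Ck_on_det assms)
    show "Ck_on k S (\<lambda>x. (\<chi> r c. if c = i then (if r = j then 1 else 0) else M x $ r $ c) $ p $ q)"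
      for p q
      using assms by (cases "q = i") (auto intro: Ck_on_const)
    show "det (M x) \<noteq> 0" if "x \<in> S" for x
      using inv[OF that] invertible_det_nz by blast
  qed
qed (simp add: matrix_inv_entry[OF inv])

section \<open>Positive definite matrices\<close>

definition positive_definite :: "real^'n^'n \<Rightarrow> bool" where
  "positive_definite P \<longleftrightarrow> transpose P = P \<and> (\<forall>v. v \<noteq> 0 \<longrightarrow> 0 < v \<bullet> (P *v v))"

lemma positive_definite_invertible:
  assumes "positive_definite P"
  shows "invertible P"
  unfolding invertible_left_inverse matrix_left_invertible_ker
proof (intro allI impI, rule ccontr)
  show False if "P *v v = 0" and "v \<noteq> 0" for v
    using assms that unfolding positive_definite_def by fastforce
qed

text \<open>With \<open>w = matrix_inv P *v v\<close> the form of the inverse at \<open>v\<close>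
  equals the form of \<open>P\<close> at \<open>w\<close>.\<close>

lemma positive_definite_matrix_inv:
  assumes "positive_definite P"
  shows "positive_definite (matrix_inv P)"
proof -
  let ?Q = "matrix_inv P"
  have inv: "P ** ?Q = mat 1" "?Q ** P = mat 1"
    using invertible_matrix_inv positive_definite_invertible[OF assms] by auto
  have sym: "transpose P = P"
    using assms positive_definite_def by blast
  have "transpose ?Q ** P = mat 1"
    using matrix_transpose_mul[of P ?Q] by (simp add: inv sym)
  then have symQ: "transpose ?Q = ?Q"
    using matrix_mul_assoc[of "transpose ?Q" P ?Q] by (simp add: inv)
  have "0 < v \<bullet> (?Q *v v)" if "v \<noteq> 0" for v
  proof -
    have v: "P *v (?Q *v v) = v"
      by (simp add: matrix_vector_mul_assoc inv)
    then have "?Q *v v \<noteq> 0"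
      using that by auto
    then have "0 < (?Q *v v) \<bullet> (P *v (?Q *v v))"
      using assms positive_definite_def by blast
    then show ?thesis
      using v by (simp add: inner_commute)
  qed
  with symQ show ?thesis
    by (simp add: positive_definite_def)
qed

lemma inner_matrix_vector_mult:
  fixes P :: "real^'n^'m"
  shows "v \<bullet> (P *v w) = (\<Sum>i\<in>UNIV. \<Sum>j\<in>UNIV. P $ i $ j * v $ i * w $ j)"
  by (simp add: inner_vec_def matrix_vector_mult_def sum_distrib_left mult_ac)

text \<open>
  Induction on the number of nonzero rows of \<open>P\<close>; the step is a Schur complement, which splits a
  rank-one form off \<open>P\<close>.
\<close>

lemma sum_mult_psd_nonneg_rows:
  fixes P S :: "real^'n^'n"
  assumes "finite I" and "transpose P = P" and "\<And>v. 0 \<le> v \<bullet> (P *v v)"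
    and "\<And>i. i \<notin> I \<Longrightarrow> P $ i = 0" and S: "\<And>v. 0 \<le> v \<bullet> (S *v v)"
  shows "0 \<le> (\<Sum>i\<in>UNIV. \<Sum>j\<in>UNIV. P $ i $ j * S $ i $ j)"
  using assms(1-4)
proof (induction I arbitrary: P rule: finite_induct)
  case empty
  then have "P $ i = 0" for i by simp
  then show ?case by simp
next
  case (insert k I)
  have symP: "P $ i $ j = P $ j $ i" for i j
    using arg_cong[OF insert.prems(1), of "\<lambda>M. M $ j $ i"] by (simp add: transpose_def)
  \<comment> \<open>The linear form given by row \<open>k\<close> of \<open>P\<close>.\<close>
  define c where "c v = axis k 1 \<bullet> (P *v v)" for v
  have c_alt: "c v = (\<Sum>j\<in>UNIV. P $ k $ j * v $ j)" for v
    by (simp add: c_def inner_axis_axis inner_axis' matrix_vector_mult_def)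
  have c_sym: "v \<bullet> (P *v axis k 1) = c v" for v
    using dot_lmul_matrix[of v P "axis k 1"] transpose_matrix_vector[of P v]
    by (simp add: c_def insert.prems(1) inner_commute)
  \<comment> \<open>A quadratic polynomial in \<open>t\<close> that is never negative. It serves
    both cases below: without its quadratic term it forces \<open>c = 0\<close>, and at its minimum
    it gives the Cauchy-Schwarz bound on \<open>c v\<close>.\<close>
  have expand: "0 \<le> v \<bullet> (P *v v) + 2 * t * c v + t\<^sup>2 * P $ k $ k" for v t
  proof -
    have "0 \<le> (v + t *\<^sub>R axis k 1) \<bullet> (P *v (v + t *\<^sub>R axis k 1))"
      by (rule insert.prems(2))
    also have "\<dots> = v \<bullet> (P *v v) + 2 * t * c v + t\<^sup>2 * P $ k $ k"
      using c_sym[of v] c_sym[of "axis k 1"] c_alt[of "axis k 1"] c_def[of v]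
      by (simp add: matrix_vector_right_distrib matrix_vector_mult_scaleR inner_add_left
          inner_add_right algebra_simps power2_eq_square axis_def if_distrib cong: if_cong)
    finally show ?thesis .
  qed
  show ?case
  proof (cases "P $ k $ k = 0")
    case True
    have "c v = 0" for v
    proof (rule ccontr)
      assume "c v \<noteq> 0"
      \<comment> \<open>With \<open>P $ k $ k = 0\<close> the polynomial is affine in
        \<open>t\<close>; this \<open>t\<close> gives it the value -1.\<close>
      then show False
        using expand[of v "- (v \<bullet> (P *v v) + 1) / (2 * c v)"] True by (simp add: field_simps)
    qed
    then have "P $ k $ j = 0" for j
      using c_alt[of "axis j 1"] by (simp add: axis_def if_distrib cong: if_cong)
    then have "P $ k = 0"
      by (simp add: vec_eq_iff)
    then have "P $ i = 0" if "i \<notin> I" for i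
      using insert.prems(3)[of i] that by (cases "i = k") auto
    then show ?thesis
      by (rule insert.IH[OF insert.prems(1,2)])
  next
    case False
    have pos: "0 < P $ k $ k"
      using insert.prems(2)[of "axis k 1"] c_sym[of "axis k 1"] c_alt[of "axis k 1"] False
      by (simp add: axis_def if_distrib cong: if_cong)
    \<comment> \<open>Row \<open>k\<close> of \<open>P'\<close> vanishes, and rows of
      \<open>P\<close> that were already zero stay zero by symmetry. The removed rank-one part
      contributes the value of the form \<open>S\<close> at row \<open>k\<close> of
      \<open>P\<close>, divided by the positive pivot.\<close>
    define P' :: "real^'n^'n" where "P' = (\<chi> i j. P $ i $ j - P $ k $ i * P $ k $ j / P $ k $ k)"
    have quad: "v \<bullet> (P' *v v) = v \<bullet> (P *v v) - (c v)\<^sup>2 / P $ k $ k" for v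
      by (simp add: inner_matrix_vector_mult P'_def c_alt power2_eq_square sum_product
          sum_divide_distrib sum_subtractf[symmetric] field_simps)
    have "0 \<le> (\<Sum>i\<in>UNIV. \<Sum>j\<in>UNIV. P' $ i $ j * S $ i $ j)"
    proof (rule insert.IH)
      show "transpose P' = P'"
        by (simp add: P'_def transpose_def vec_eq_iff symP mult.commute)
      show "0 \<le> v \<bullet> (P' *v v)" for v
        using expand[of v "- c v / P $ k $ k"] pos unfolding quad
        by (simp add: power2_eq_square field_simps)
      show "P' $ i = 0" if "i \<notin> I" for i
        using insert.prems(3)[of i] that pos symP[of k i]
        by (cases "i = k") (simp_all add: P'_def vec_eq_iff)
    qed
    moreover have "0 \<le> (P $ k) \<bullet> (S *v (P $ k)) / P $ k $ k"
      using S pos by simp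
    moreover have "(\<Sum>i\<in>UNIV. \<Sum>j\<in>UNIV. P $ i $ j * S $ i $ j) =
      (\<Sum>i\<in>UNIV. \<Sum>j\<in>UNIV. P' $ i $ j * S $ i $ j) + (P $ k) \<bullet> (S *v (P $ k)) / P $ k $ k"
      by (simp add: inner_matrix_vector_mult P'_def sum_divide_distrib sum.distrib[symmetric]
          field_simps)
    ultimately show ?thesis by linarith
  qed
qed

lemma sum_mult_psd_nonneg:
  fixes P S :: "real^'n^'n"
  assumes "transpose P = P" and "\<And>v. 0 \<le> v \<bullet> (P *v v)" and "\<And>v. 0 \<le> v \<bullet> (S *v v)"
  shows "0 \<le> (\<Sum>i\<in>UNIV. \<Sum>j\<in>UNIV. P $ i $ j * S $ i $ j)"
  by (rule sum_mult_psd_nonneg_rows[where I = UNIV]) (use assms in auto)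

text \<open>The constant is the minimum of the quadratic form on the unit sphere; homogeneity
  extends the bound to all vectors.\<close>

lemma positive_definite_coercive:
  fixes P :: "real^'n^'n"
  assumes "positive_definite P"
  obtains e where "0 < e" and "\<And>v. e * (v \<bullet> v) \<le> v \<bullet> (P *v v)"
proof -
  have "continuous_on (sphere 0 1) (\<lambda>v. v \<bullet> (P *v v))"
    by (intro continuous_intros matrix_vector_mult_linear_continuous_on)
  moreover have "sphere 0 (1::real) \<noteq> ({}::(real^'n) set)"
    by simp
  ultimately obtain w where w: "w \<in> sphere 0 1"
    and min: "\<And>v. v \<in> sphere 0 1 \<Longrightarrow> w \<bullet> (P *v w) \<le> v \<bullet> (P *v v)"
    using continuous_attains_inf[OF compact_sphere] by blast
  show thesis
  proof
    show "0 < w \<bullet> (P *v w)"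
      using w assms by (auto simp: positive_definite_def dest!: spec[of _ w])
    show "(w \<bullet> (P *v w)) * (v \<bullet> v) \<le> v \<bullet> (P *v v)" for v
    proof (cases "v = 0")
      case False
      have "w \<bullet> (P *v w) \<le> (v /\<^sub>R norm v) \<bullet> (P *v (v /\<^sub>R norm v))"
        using False by (intro min) simp
      also have "\<dots> = (v \<bullet> (P *v v)) / (v \<bullet> v)"
        by (simp add: matrix_vector_mult_scaleR dot_square_norm power2_eq_square divide_inverse)
      finally show ?thesis
        using False by (simp add: field_simps)
    qed simp
  qed
qed

section \<open>Traces taken with respect to a metric\<close>

lemma trace_eq_sum_transpose:
  fixes P S :: "real^'n^'n"
  shows "trace (P ** S) = (\<Sum>i\<in>UNIV. \<Sum>j\<in>UNIV. P $ i $ j * transpose S $ i $ j)"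
  by (simp add: trace_def matrix_matrix_mult_def transpose_def)

text \<open>For \<open>P\<close> the inverse metric this is the squared norm of the tensor
  \<open>a\<close>. It is the contraction of \<open>P\<close> with \<open>S = a P a\<close>, a
  semidefinite matrix whose diagonal entries are the \<open>P\<close>-norms squared of the columns
  of \<open>a\<close>; no diagonalisation is required.\<close>

lemma trace_square_nonneg:
  fixes P a :: "real^'n^'n"
  assumes P: "positive_definite P" and a: "transpose a = a"
  shows "0 \<le> trace (P ** a ** P ** a)" and "trace (P ** a ** P ** a) = 0 \<Longrightarrow> a = 0"
proof -
  define S where "S = a ** P ** a"
  have symP: "transpose P = P" and Ppos: "0 \<le> v \<bullet> (P *v v)" for v
    using P unfolding positive_definite_def by (auto, cases "v = 0", auto simp: less_imp_le)
  have tS: "transpose S = S"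
    by (simp add: S_def matrix_transpose_mul a symP matrix_mul_assoc)
  have S: "v \<bullet> (S *v v) = (a *v v) \<bullet> (P *v (a *v v))" for v
    using dot_lmul_matrix[of v a "P *v (a *v v)"] transpose_matrix_vector[of a v]
    by (simp add: S_def a flip: matrix_vector_mul_assoc)
  have tr: "trace (P ** a ** P ** a) = (\<Sum>i\<in>UNIV. \<Sum>j\<in>UNIV. P $ i $ j * S $ i $ j)"
    using trace_eq_sum_transpose[of P S] tS by (simp add: S_def matrix_mul_assoc)
  show "0 \<le> trace (P ** a ** P ** a)"
    unfolding tr by (rule sum_mult_psd_nonneg) (use symP Ppos S in auto)
  assume 0: "trace (P ** a ** P ** a) = 0"
  obtain e where e: "0 < e" "\<And>v. e * (v \<bullet> v) \<le> v \<bullet> (P *v v)"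
    using positive_definite_coercive[OF P] by blast
  \<comment> \<open>Coercivity leaves \<open>P - mat e\<close> semidefinite, so contracting it with
    \<open>S\<close> bounds \<open>e\<close> times the sum of the diagonal of \<open>S\<close> by
    the vanishing trace. The nonnegative diagonal entries must then all be zero.\<close>
  have "0 \<le> (\<Sum>i\<in>UNIV. \<Sum>j\<in>UNIV. (P - mat e) $ i $ j * S $ i $ j)"
  proof (rule sum_mult_psd_nonneg)
    have "transpose (mat e :: real^'n^'n) = mat e"
      by (rule transpose_mat)
    then show "transpose (P - mat e) = P - mat e"
      using symP by (simp add: transpose_def vec_eq_iff)
    have "mat e *v v = e *\<^sub>R v" for v :: "real^'n"
      by (simp add: matrix_vector_mult_def mat_def vec_eq_iff if_distrib if_distribR cong: if_cong)
    then show "0 \<le> v \<bullet> ((P - mat e) *v v)" for v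
      using e(2)[of v] by (simp add: matrix_vector_mult_diff_rdistrib inner_diff_right)
    show "0 \<le> v \<bullet> (S *v v)" for v
      using S Ppos by simp
  qed
  also have "\<dots> = (\<Sum>i\<in>UNIV. \<Sum>j\<in>UNIV.
      P $ i $ j * S $ i $ j - (if i = j then e * S $ i $ j else 0))"
    by (intro sum.cong refl) (simp add: mat_def left_diff_distrib)
  also have "\<dots> = - e * (\<Sum>i\<in>UNIV. S $ i $ i)"
    using 0 unfolding tr by (simp add: sum_subtractf sum_distrib_left sum_negf)
  finally have le: "(\<Sum>i\<in>UNIV. S $ i $ i) \<le> 0"
    using e(1) by (simp add: mult_le_0_iff zero_le_mult_iff)
  have Sii: "S $ i $ i = column i a \<bullet> (P *v column i a)" for i
    using S[of "axis i 1"] by (simp add: matrix_vector_mult_basis inner_axis' column_def)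
  have "(\<Sum>i\<in>UNIV. S $ i $ i) = 0"
    using le Sii Ppos by (intro antisym sum_nonneg) auto
  then have "column i a \<bullet> (P *v column i a) = 0" for i
    using Sii Ppos by (subst (asm) sum_nonneg_eq_0_iff) auto
  then have "column i a = 0" for i
    using P unfolding positive_definite_def by (metis less_irrefl)
  then show "a = 0"
    by (simp add: column_def vec_eq_iff)
qed

text \<open>The equation for \<open>G\<close> forces \<open>J\<close> to be invertible, so
  \<open>J ** matrix_inv G ** transpose J\<close> is the inverse of \<open>G'\<close>; cyclicity of
  the trace does the rest. With \<open>J\<close> a Jacobian this is the invariance of the metric
  trace.\<close>

lemma trace_inverse_congruence:
  fixes G G' J H :: "real^'n^'n"
  assumes G: "invertible G" and G': "invertible G'" and eq: "G = transpose J ** G' ** J"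
  shows "trace (matrix_inv G ** (transpose J ** H ** J)) = trace (matrix_inv G' ** H)"
proof -
  let ?P = "matrix_inv G"
  have "transpose J ** (G' ** J ** ?P) = mat 1"
    using invertible_matrix_inv(1)[OF G] eq by (simp add: matrix_mul_assoc)
  then have "G' ** (J ** ?P ** transpose J) = mat 1"
    using matrix_left_right_inverse[of "transpose J" "G' ** J ** ?P"]
    by (simp add: matrix_mul_assoc)
  then have "J ** ?P ** transpose J = matrix_inv G'"
    using matrix_mul_assoc[of "matrix_inv G'" G' "J ** ?P ** transpose J"]
    by (simp add: invertible_matrix_inv[OF G'])
  moreover have "trace (?P ** (transpose J ** H ** J)) = trace (J ** ?P ** transpose J ** H)"
    using trace_mul_sym[of "?P ** transpose J ** H" J] by (simp add: matrix_mul_assoc)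
  ultimately show ?thesis by simp
qed

section \<open>Propagation of positivity for parabolic supersolutions\<close>

text \<open>If \<open>c < 0\<close>, the first derivative is negative immediately to the right of 0,
  and the mean value theorem produces a smaller value of \<open>p\<close>.\<close>

lemma second_derivative_test_real:
  fixes p p' :: "real \<Rightarrow> real"
  assumes "0 < d" and min: "\<And>s. \<bar>s\<bar> < d \<Longrightarrow> p 0 \<le> p s"
    and der: "\<And>s. \<bar>s\<bar> < d \<Longrightarrow> (p has_real_derivative p' s) (at s)"
    and der2: "(p' has_real_derivative c) (at 0)"
  shows "p' 0 = 0" and "0 \<le> c"
proof -
  show p'0: "p' 0 = 0"
    using DERIV_local_min[OF der[of 0] \<open>0 < d\<close>] min \<open>0 < d\<close> by simp
  show "0 \<le> c"
  proof (rule ccontr)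
    assume "\<not> 0 \<le> c"
    then obtain e where e: "0 < e" "\<And>h. 0 < h \<Longrightarrow> h < e \<Longrightarrow> p' h < 0"
      using DERIV_neg_dec_right[OF der2] p'0 by auto
    define h where "h = min d e / 2"
    have h: "0 < h" "h < d" "h < e"
      using \<open>0 < d\<close> e(1) by (auto simp: h_def min_def)
    obtain z where z: "0 < z" "z < h" "p h - p 0 = (h - 0) * p' z"
      using MVT2[of 0 h p p'] der h by auto
    have "p' z < 0"
      using e(2) z h by simp
    then have "p h < p 0"
      using z(3) h by (simp add: mult_less_0_iff flip: less_diff_eq)
        (smt (verit) mult_pos_neg)
    then show False
      using min[of h] h by simp
  qed
qed

text \<open>Reduction to the lines \<open>x + s *\<^sub>R w\<close>. The conclusion speaks of the
  quadratic form because symmetry of the numbers \<open>vij\<close> is not among the data.\<close>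

lemma second_derivative_test:
  fixes v :: "real^'n \<Rightarrow> real"
  assumes "0 < d" and min: "\<And>y. y \<in> ball x d \<Longrightarrow> v x \<le> v y"
    and D1: "\<And>y. y \<in> ball x d \<Longrightarrow> (v has_derivative (\<lambda>h. \<Sum>j\<in>UNIV. h $ j * vj j y)) (at y)"
    and D2: "\<And>j. (vj j has_derivative (\<lambda>h. \<Sum>i\<in>UNIV. h $ i * vij i j)) (at x)"
  shows "vj j x = 0"
    and "0 \<le> w \<bullet> ((\<chi> i j. vij i j) *v w)"
proof -
  have line: "(\<Sum>j\<in>UNIV. w $ j * vj j x) = 0 \<and> 0 \<le> w \<bullet> ((\<chi> i j. vij i j) *v w)" for w :: "real^'n"
  proof (cases "w = 0")
    case False
    define e where "e = d / norm w"
    have e: "0 < e" using \<open>0 < d\<close> False by (simp add: e_def)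
    have inb: "x + s *\<^sub>R w \<in> ball x d" if "\<bar>s\<bar> < e" for s
      using that False by (simp add: dist_norm e_def field_simps)
    define p' where "p' s = (\<Sum>j\<in>UNIV. w $ j * vj j (x + s *\<^sub>R w))" for s
    have lin: "((\<lambda>s. x + s *\<^sub>R w) has_derivative (\<lambda>s. s *\<^sub>R w)) (at s)" for s
      by (auto intro!: derivative_eq_intros)
    have d1: "((\<lambda>s. v (x + s *\<^sub>R w)) has_real_derivative p' s) (at s)" if "\<bar>s\<bar> < e" for s
    proof -
      have "((\<lambda>s. v (x + s *\<^sub>R w)) has_derivative
          (\<lambda>s'. \<Sum>j\<in>UNIV. (s' *\<^sub>R w) $ j * vj j (x + s *\<^sub>R w))) (at s)"
        by (rule has_derivative_compose[OF lin D1[OF inb[OF that]]])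
      then show ?thesis
        by (rule has_derivative_imp_has_field_derivative) (simp add: p'_def sum_distrib_left mult_ac)
    qed
    have d2: "(p' has_real_derivative (\<Sum>j\<in>UNIV. w $ j * (\<Sum>i\<in>UNIV. w $ i * vij i j))) (at 0)"
      unfolding p'_def
    proof (intro DERIV_sum DERIV_cmult)
      fix j
      have "((\<lambda>s. vj j (x + s *\<^sub>R w)) has_derivative
          (\<lambda>s'. \<Sum>i\<in>UNIV. (s' *\<^sub>R w) $ i * vij i j)) (at 0)"
        by (rule has_derivative_compose[OF lin]) (use D2[of j] in simp)
      then show "((\<lambda>s. vj j (x + s *\<^sub>R w)) has_real_derivative (\<Sum>i\<in>UNIV. w $ i * vij i j)) (at 0)"
        by (rule has_derivative_imp_has_field_derivative) (simp add: sum_distrib_left mult_ac)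
    qed
    have "p' 0 = 0" "0 \<le> (\<Sum>j\<in>UNIV. w $ j * (\<Sum>i\<in>UNIV. w $ i * vij i j))"
      using second_derivative_test_real[OF e _ d1 d2] min inb by auto
    moreover have "(\<Sum>j\<in>UNIV. w $ j * (\<Sum>i\<in>UNIV. w $ i * vij i j)) = w \<bullet> ((\<chi> i j. vij i j) *v w)"
      by (subst inner_matrix_vector_mult, subst sum.swap) (simp add: sum_distrib_left mult_ac)
    ultimately show ?thesis
      by (simp add: p'_def)
  qed simp
  show "0 \<le> w \<bullet> ((\<chi> i j. vij i j) *v w)"
    using line by blast
  show "vj j x = 0"
    using line[of "axis j 1"] by (simp add: axis_def if_distrib if_distribR cong: if_cong)
qed

text \<open>Supplies the decay rate of the barrier. On the compact set where
  \<open>F \<ge> 0\<close>, \<open>q\<close> is positive and hence bounded below, so a large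
  multiple of its square outweighs the maximum of \<open>F\<close>.\<close>

lemma compact_absorb_positive:
  fixes F q :: "'a::topological_space \<Rightarrow> real"
  assumes "compact D" and "continuous_on D F" and "continuous_on D q"
    and "\<And>z. z \<in> D \<Longrightarrow> 0 \<le> q z" and neg: "\<And>z. z \<in> D \<Longrightarrow> q z = 0 \<Longrightarrow> F z < 0"
  obtains K where "\<And>z. z \<in> D \<Longrightarrow> F z - K * (q z)\<^sup>2 < 0"
proof (cases "D \<inter> F -` {0..} = {}")
  case True
  have "F z - 0 * (q z)\<^sup>2 < 0" if "z \<in> D" for z
    using True that by force
  then show thesis by (rule that)
next
  case False
  define E where "E = D \<inter> F -` {0..}"
  have "compact E"
    unfolding E_def vimage_def
    using closedin_compact[OF assms(1) continuous_closedin_preimage[OF assms(2) closed_atLeast[of 0]]]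
    by (simp add: vimage_def)
  have contE: "continuous_on E F" "continuous_on E q"
    using assms(2,3) by (auto intro: continuous_on_subset simp: E_def)
  have "E \<noteq> {}" using False by (simp add: E_def)
  obtain z0 where z0: "z0 \<in> E" "\<And>z. z \<in> E \<Longrightarrow> q z0 \<le> q z"
    using continuous_attains_inf[OF \<open>compact E\<close> \<open>E \<noteq> {}\<close> contE(2)] by blast
  obtain z1 where z1: "z1 \<in> E" "\<And>z. z \<in> E \<Longrightarrow> F z \<le> F z1"
    using continuous_attains_sup[OF \<open>compact E\<close> \<open>E \<noteq> {}\<close> contE(1)] by blast
  have q0: "0 < q z0"
    using z0(1) assms(4)[of z0] neg[of z0] by (force simp: E_def)
  have F1: "0 \<le> F z1" using z1(1) by (simp add: E_def)
  \<comment> \<open>The summand 1 makes the final inequality strict.\<close>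
  define K where "K = (F z1 + 1) / (q z0)\<^sup>2"
  have Kpos: "0 \<le> K" using F1 by (simp add: K_def)
  have "F z - K * (q z)\<^sup>2 < 0" if "z \<in> D" for z
  proof (cases "0 \<le> F z")
    case True
    then have zE: "z \<in> E" using that by (simp add: E_def)
    have "(q z0)\<^sup>2 \<le> (q z)\<^sup>2"
      using z0(2)[OF zE] q0 by (simp add: power_mono)
    then have "K * (q z0)\<^sup>2 \<le> K * (q z)\<^sup>2"
      using Kpos by (rule mult_left_mono)
    moreover have "K * (q z0)\<^sup>2 = F z1 + 1"
      using q0 by (simp add: K_def)
    ultimately show ?thesis
      using z1(2)[OF zE] by linarith
  next
    case False
    then show ?thesis
      using Kpos by (smt (verit) mult_nonneg_nonneg zero_le_power2)
  qed
  then show thesis by (rule that)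
qed

text \<open>
  The barrier is \<open>w = \<epsilon> exp (-K (\<tau> - s)) q\<^sup>2\<close> with \<open>q = \<rho>(\<tau>) - |y - x0|\<^sup>2\<close>, where the radius \<open>\<surd>\<rho>\<close> grows from a small
  \<open>\<delta>\<close> at time \<open>s\<close> to \<open>r < R\<close> at time \<open>t\<close>.  Up to a positive factor, the parabolic operator turns \<open>w\<close> into
  \<open>F - K q\<^sup>2\<close>.  Ellipticity makes \<open>F\<close> negative where \<open>q = 0\<close>, so \<open>w\<close> is a strict subsolution for large \<open>K\<close>
  and \<open>f - w\<close> has no negative minimum.
\<close>

lemma parabolic_positivity_spreads:
  fixes f ft :: "real \<Rightarrow> real^'n \<Rightarrow> real" and fj :: "real \<Rightarrow> 'n \<Rightarrow> real^'n \<Rightarrow> real"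
    and fij :: "real \<Rightarrow> 'n \<Rightarrow> 'n \<Rightarrow> real^'n \<Rightarrow> real"
    and a :: "real \<Rightarrow> real^'n \<Rightarrow> real^'n^'n" and b :: "real \<Rightarrow> real^'n \<Rightarrow> real^'n"
  assumes "s < t"
    and contf: "continuous_on ({s..t} \<times> cball x0 R) (\<lambda>z. f (fst z) (snd z))"
    and conta: "continuous_on ({s..t} \<times> cball x0 R) (\<lambda>z. a (fst z) (snd z))"
    and contb: "continuous_on ({s..t} \<times> cball x0 R) (\<lambda>z. b (fst z) (snd z))"
    and apos: "\<And>\<tau> x. \<tau> \<in> {s..t} \<Longrightarrow> x \<in> cball x0 R \<Longrightarrow> positive_definite (a \<tau> x)"
    and Dt: "\<And>\<tau> x. \<tau> \<in> {s..t} \<Longrightarrow> x \<in> ball x0 R \<Longrightarrow>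
      ((\<lambda>\<sigma>. f \<sigma> x) has_real_derivative ft \<tau> x) (at \<tau>)"
    and D1: "\<And>\<tau> x. \<tau> \<in> {s..t} \<Longrightarrow> x \<in> ball x0 R \<Longrightarrow>
      (f \<tau> has_derivative (\<lambda>h. \<Sum>j\<in>UNIV. h $ j * fj \<tau> j x)) (at x)"
    and D2: "\<And>\<tau> x j. \<tau> \<in> {s..t} \<Longrightarrow> x \<in> ball x0 R \<Longrightarrow>
      (fj \<tau> j has_derivative (\<lambda>h. \<Sum>i\<in>UNIV. h $ i * fij \<tau> i j x)) (at x)"
    and super: "\<And>\<tau> x. \<tau> \<in> {s..t} \<Longrightarrow> x \<in> ball x0 R \<Longrightarrow>
      (\<Sum>i\<in>UNIV. \<Sum>j\<in>UNIV. a \<tau> x $ i $ j * fij \<tau> i j x) + (\<Sum>k\<in>UNIV. b \<tau> x $ k * fj \<tau> k x)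
      \<le> ft \<tau> x"
    and nonneg: "\<And>\<tau> x. \<tau> \<in> {s..t} \<Longrightarrow> x \<in> cball x0 R \<Longrightarrow> 0 \<le> f \<tau> x"
    and pos: "0 < f s x0" and x: "x \<in> ball x0 R"
  shows "0 < f t x"
proof -
  \<comment> \<open>A radius strictly between: the final support must contain \<open>x\<close> in
    its interior and stay inside the open ball where the derivatives are given.\<close>
  define r where "r = (dist x0 x + R) / 2"
  have r: "dist x0 x < r" "0 < r" "r < R"
    using x by (auto simp: r_def) (smt (verit) zero_le_dist field_sum_of_halves)
  \<comment> \<open>Half the initial value, so that continuity keeps \<open>f s\<close> above
    \<open>c\<close> on a whole ball of radius \<delta>.\<close>
  define c where "c = f s x0 / 2"
  have "continuous_on (cball x0 R) (\<lambda>y. f (fst (s, y)) (snd (s, y)))"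
    by (rule continuous_on_compose2[OF contf]) (use \<open>s < t\<close> in \<open>auto intro!: continuous_intros\<close>)
  moreover have "x0 \<in> cball x0 R" "0 < c"
    using r pos by (auto simp: c_def)
  ultimately have "\<exists>d>0. \<forall>y\<in>cball x0 R. dist y x0 < d \<longrightarrow> dist (f s y) (f s x0) < c"
    unfolding continuous_on_iff fst_conv snd_conv by blast
  then obtain d0 where d0: "0 < d0"
    "\<And>y. y \<in> cball x0 R \<Longrightarrow> dist y x0 < d0 \<Longrightarrow> dist (f s y) (f s x0) < c"
    by blast
  define \<delta> where "\<delta> = min d0 r / 2"
  have \<delta>: "0 < \<delta>" "\<delta> < d0" "\<delta> < r"
    using d0(1) r by (auto simp: \<delta>_def min_def)
  have initial: "c < f s y" if "dist x0 y \<le> \<delta>" for y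
    using d0(2)[of y] that \<delta> r by (simp add: dist_commute dist_real_def c_def)
      (smt (verit) field_sum_of_halves)
  \<comment> \<open>The speed at which the squared radius grows from the square of \<delta> at time
    \<open>s\<close> to the square of \<open>r\<close> at time \<open>t\<close>.\<close>
  define m where "m = (r\<^sup>2 - \<delta>\<^sup>2) / (t - s)"
  have m: "0 < m"
    using \<delta> \<open>s < t\<close> by (simp add: m_def power_strict_mono)
  define q where "q \<tau> y = \<delta>\<^sup>2 + m * (\<tau> - s) - (y - x0) \<bullet> (y - x0)" for \<tau> and y :: "real^'n"
  have qt: "q t y = r\<^sup>2 - (y - x0) \<bullet> (y - x0)" for y
    using \<open>s < t\<close> by (simp add: q_def m_def)
  have q_mono: "q \<tau> y \<le> q t y" if "\<tau> \<le> t" for \<tau> y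
    using that m by (simp add: q_def)
  have inball: "y \<in> ball x0 R" if "0 \<le> q \<tau> y" "\<tau> \<le> t" for \<tau> y
  proof -
    have "(norm (y - x0))\<^sup>2 \<le> r\<^sup>2"
      using q_mono[OF that(2), of y] that(1) by (simp add: qt power2_norm_eq_inner)
    then have "norm (y - x0) \<le> r"
      using r by (simp add: power2_le_iff_abs_le)
    then show ?thesis
      using r by (simp add: dist_norm norm_minus_commute)
  qed
  have contq: "continuous_on A (\<lambda>z. q (fst z) (snd z))" for A
    unfolding q_def by (intro continuous_intros)
  \<comment> \<open>The closed support of the barrier in space-time; the minimum is sought over this
    set only.\<close>
  define D where "D = ({s..t} \<times> cball x0 R) \<inter> (\<lambda>z. q (fst z) (snd z)) -` {0..}"
  have "compact ({s..t} \<times> cball x0 R)"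
    by (intro compact_Times) auto
  then have "compact D"
    unfolding D_def
    by (rule closedin_compact) (intro continuous_closedin_preimage contq closed_atLeast)
  have D: "(\<tau>, y) \<in> D \<longleftrightarrow> \<tau> \<in> {s..t} \<and> 0 \<le> q \<tau> y" for \<tau> y
    using inball[of \<tau> y] by (auto simp: D_def)
  have sub: "D \<subseteq> {s..t} \<times> cball x0 R"
    by (auto simp: D_def)
  \<comment> \<open>Terms of the time derivative of \<open>w\<close> minus the elliptic operator
    applied to \<open>w\<close>, divided by the exponential factor: the growth of the radius, the
    two parts of the second derivatives of the square of \<open>q\<close>, and the drift. Only the
    decay term is left out. Where \<open>q = 0\<close>, only the term with coefficient 8
    survives.\<close>
  define F where "F z = 2 * q (fst z) (snd z) * m
      - 8 * ((snd z - x0) \<bullet> (a (fst z) (snd z) *v (snd z - x0)))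
      + 4 * q (fst z) (snd z) * trace (a (fst z) (snd z))
      + 4 * q (fst z) (snd z) * (b (fst z) (snd z) \<bullet> (snd z - x0))" for z
  have "continuous_on D (\<lambda>z. a (fst z) (snd z))"
    and contbD: "continuous_on D (\<lambda>z. b (fst z) (snd z))"
    using conta contb sub by (auto intro: continuous_on_subset)
  then have contaD: "continuous_on D (\<lambda>z. a (fst z) (snd z) $ i $ j)" for i j
    by (intro continuous_intros)
  have contF: "continuous_on D F"
    unfolding F_def inner_matrix_vector_mult trace_def
    by (intro continuous_intros contq contaD contbD)
  have Fneg: "F z < 0" if "z \<in> D" "q (fst z) (snd z) = 0" for z
  proof -
    obtain \<tau> y where z: "z = (\<tau>, y)" by (cases z)
    have "\<tau> \<in> {s..t}" "y \<in> ball x0 R"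
      using that D inball[of \<tau> y] by (auto simp: z)
    then have "positive_definite (a \<tau> y)"
      using apos by auto
    \<comment> \<open>The initial radius is positive, so the centre never lies on the boundary
      \<open>q = 0\<close>.\<close>
    moreover have "y - x0 \<noteq> 0"
    proof
      assume "y - x0 = 0"
      then have "\<delta>\<^sup>2 + m * (\<tau> - s) = 0"
        using that(2) by (simp add: z q_def)
      moreover have "0 < \<delta>\<^sup>2" "0 \<le> m * (\<tau> - s)"
        using \<delta> m \<open>\<tau> \<in> {s..t}\<close> by auto
      ultimately show False by linarith
    qed
    ultimately have "0 < (y - x0) \<bullet> (a \<tau> y *v (y - x0))"
      unfolding positive_definite_def by blast
    then show ?thesis
      using that(2) by (simp add: F_def z)
  qed
  have q_nonneg: "0 \<le> q (fst z) (snd z)" if "z \<in> D" for z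
    using that by (simp add: D_def)
  obtain K where K: "\<And>z. z \<in> D \<Longrightarrow> F z - K * (q (fst z) (snd z))\<^sup>2 < 0"
    using compact_absorb_positive[OF \<open>compact D\<close> contF contq q_nonneg Fneg] by blast
  \<comment> \<open>The normalisation makes the barrier at most \<open>c\<close> at time
    \<open>s\<close>, because \<open>q\<close> is then at most the square of \<delta>.\<close>
  define E where "E \<tau> = c / (\<delta>\<^sup>2)\<^sup>2 * exp (- K * (\<tau> - s))" for \<tau>
  have E: "0 < E \<tau>" for \<tau>
    using pos \<delta> by (simp add: E_def c_def)
  define v where "v \<tau> y = f \<tau> y - E \<tau> * (q \<tau> y)\<^sup>2" for \<tau> y
  have "continuous_on D (\<lambda>z. v (fst z) (snd z))"
    unfolding v_def E_def
    by (intro continuous_intros contq continuous_on_subset[OF contf sub])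
  have v_nonneg: "0 \<le> v \<tau> y" if inD: "(\<tau>, y) \<in> D" for \<tau> y
  proof (rule ccontr)
    assume "\<not> 0 \<le> v \<tau> y"
    obtain z where z: "z \<in> D" "\<And>z'. z' \<in> D \<Longrightarrow> v (fst z) (snd z) \<le> v (fst z') (snd z')"
      using continuous_attains_inf[OF \<open>compact D\<close> _ \<open>continuous_on D (\<lambda>z. v (fst z) (snd z))\<close>] inD
      by blast
    obtain \<tau> y where \<tau>y: "z = (\<tau>, y)" by (cases z)
    have vneg: "v \<tau> y < 0"
      using z(2)[OF inD] \<open>\<not> 0 \<le> v _ _\<close> by (simp add: \<tau>y)
    have \<tau>: "\<tau> \<in> {s..t}" and "0 \<le> q \<tau> y"
      using z(1) D by (auto simp: \<tau>y)
    have y: "y \<in> ball x0 R"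
      using inball[of \<tau> y] \<tau> \<open>0 \<le> q \<tau> y\<close> by simp
    have "0 \<le> f \<tau> y"
      using nonneg \<tau> y by simp
    \<comment> \<open>On the edge of the support the barrier vanishes and \<open>v\<close> equals
      \<open>f\<close>, so a negative minimum lies inside.\<close>
    have q: "0 < q \<tau> y"
      using \<open>0 \<le> q \<tau> y\<close> \<open>0 \<le> f \<tau> y\<close> vneg by (cases "q \<tau> y = 0") (auto simp: v_def)
    have "s < \<tau>"
    proof (rule ccontr)
      assume "\<not> s < \<tau>"
      then have [simp]: "\<tau> = s" using \<tau> by simp
      have "(norm (y - x0))\<^sup>2 \<le> \<delta>\<^sup>2" and "q \<tau> y \<le> \<delta>\<^sup>2"
        using q by (simp_all add: q_def power2_norm_eq_inner)
      then have "c < f s y"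
        using initial[of y] \<delta> by (simp add: dist_norm norm_minus_commute power2_le_iff_abs_le)
      moreover have "(q \<tau> y)\<^sup>2 \<le> (\<delta>\<^sup>2)\<^sup>2"
        using \<open>q \<tau> y \<le> \<delta>\<^sup>2\<close> q by (intro power_mono) auto
      moreover have "E s * (\<delta>\<^sup>2)\<^sup>2 = c"
        using \<delta> by (simp add: E_def)
      ultimately have "E s * (q \<tau> y)\<^sup>2 < f s y"
        using mult_left_mono[of "(q \<tau> y)\<^sup>2" "(\<delta>\<^sup>2)\<^sup>2" "E s"] E[of s] by simp
      then show False
        using vneg by (simp add: v_def)
    qed
    \<comment> \<open>Positivity of \<open>q\<close> persists nearby, so a small ball at time \<tau>
      stays in \<open>D\<close> and the minimum over \<open>D\<close> is a local minimum in
      space.\<close>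
    have "open {z. z \<in> ball x0 R \<and> 0 < q \<tau> z}"
      unfolding q_def mem_ball by (intro open_Collect_conj open_Collect_less continuous_intros)
    then obtain d where d: "0 < d" "ball y d \<subseteq> {z. z \<in> ball x0 R \<and> 0 < q \<tau> z}"
      using y q unfolding open_contains_ball by blast
    define vj where "vj j z = fj \<tau> j z + 4 * E \<tau> * (q \<tau> z * (z - x0) $ j)" for j z
    define vij where "vij i j = fij \<tau> i j y
      + 4 * E \<tau> * ((if i = j then q \<tau> y else 0) - 2 * (y - x0) $ i * (y - x0) $ j)" for i j
    have dq: "(q \<tau> has_derivative (\<lambda>h. - 2 * (h \<bullet> (z - x0)))) (at z)" for z
      unfolding q_def by (auto intro!: derivative_eq_intros simp: fun_eq_iff inner_commute)
    have vj: "(v \<tau> has_derivative (\<lambda>h. \<Sum>j\<in>UNIV. h $ j * vj j z)) (at z)" if "z \<in> ball y d" for z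
    proof -
      have "(f \<tau> has_derivative (\<lambda>h. \<Sum>j\<in>UNIV. h $ j * fj \<tau> j z)) (at z)"
        using D1[OF \<tau>] d that by blast
      from has_derivative_diff[OF this has_derivative_mult_right[OF has_derivative_power[OF dq, of 2], of "E \<tau>"]]
      show ?thesis
        unfolding v_def[abs_def]
      proof (rule has_derivative_eq_rhs, intro ext)
        fix h :: "real^'n"
        have "(\<Sum>j\<in>UNIV. h $ j * vj j z) =
          (\<Sum>j\<in>UNIV. h $ j * fj \<tau> j z + 4 * E \<tau> * q \<tau> z * (h $ j * (z - x0) $ j))"
          by (intro sum.cong refl) (simp add: vj_def algebra_simps)
        also have "\<dots> = (\<Sum>j\<in>UNIV. h $ j * fj \<tau> j z) + 4 * E \<tau> * q \<tau> z * (h \<bullet> (z - x0))"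
          by (simp add: sum.distrib inner_vec_def flip: sum_distrib_left)
        finally show "(\<Sum>j\<in>UNIV. h $ j * fj \<tau> j z) -
            E \<tau> * (of_nat 2 * (- 2 * (h \<bullet> (z - x0))) * q \<tau> z ^ (2 - 1)) =
          (\<Sum>j\<in>UNIV. h $ j * vj j z)"
          by simp
      qed
    qed
    have vij: "(vj j has_derivative (\<lambda>h. \<Sum>i\<in>UNIV. h $ i * vij i j)) (at y)" for j
    proof -
      have "((\<lambda>z. (z - x0) $ j) has_derivative (\<lambda>h. h $ j)) (at y)"
        by (auto intro!: derivative_eq_intros bounded_linear_imp_has_derivative bounded_linear_vec_nth)
      from has_derivative_add[OF D2[OF \<tau> y] has_derivative_mult_right[OF has_derivative_mult[OF dq this], of "4 * E \<tau>"]]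
      have "((\<lambda>z. fj \<tau> j z + 4 * E \<tau> * (q \<tau> z * (z - x0) $ j)) has_derivative
          (\<lambda>h. (\<Sum>i\<in>UNIV. h $ i * fij \<tau> i j y)
            + 4 * E \<tau> * (q \<tau> y * h $ j + - 2 * (h \<bullet> (y - x0)) * (y - x0) $ j))) (at y)" .
      moreover have "(\<Sum>i\<in>UNIV. h $ i * vij i j) = (\<Sum>i\<in>UNIV. h $ i * fij \<tau> i j y)
            + 4 * E \<tau> * (q \<tau> y * h $ j + - 2 * (h \<bullet> (y - x0)) * (y - x0) $ j)" for h :: "real^'n"
      proof -
        have "(\<Sum>i\<in>UNIV. h $ i * vij i j) = (\<Sum>i\<in>UNIV. h $ i * fij \<tau> i j y
            + (if i = j then 4 * E \<tau> * (h $ i * q \<tau> y) else 0)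
            - 8 * E \<tau> * (y - x0) $ j * (h $ i * (y - x0) $ i))"
          by (intro sum.cong refl) (simp add: vij_def algebra_simps)
        also have "\<dots> = (\<Sum>i\<in>UNIV. h $ i * fij \<tau> i j y)
            + 4 * E \<tau> * (h $ j * q \<tau> y) - 8 * E \<tau> * (y - x0) $ j * (h \<bullet> (y - x0))"
          by (simp add: sum.distrib sum_subtractf inner_vec_def flip: sum_distrib_left)
        also have "\<dots> = (\<Sum>i\<in>UNIV. h $ i * fij \<tau> i j y)
            + 4 * E \<tau> * (q \<tau> y * h $ j + - 2 * (h \<bullet> (y - x0)) * (y - x0) $ j)"
          by (simp add: algebra_simps)
        finally show ?thesis .
      qed
      ultimately show ?thesis
        by (simp add: vj_def[abs_def])
    qed
    have minv: "v \<tau> y \<le> v \<tau> z" if "z \<in> ball y d" for z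
      using z(2)[of "(\<tau>, z)"] that d(2) \<tau> by (force simp: \<tau>y D)
    note test = second_derivative_test[OF d(1) minv vj vij]
    have fj: "fj \<tau> k y = - 4 * E \<tau> * q \<tau> y * (y - x0) $ k" for k
      using test(1)[of k] by (simp add: vj_def)
    have posdef: "positive_definite (a \<tau> y)"
      using apos \<tau> y by simp
    have "0 \<le> (\<Sum>i\<in>UNIV. \<Sum>j\<in>UNIV. a \<tau> y $ i $ j * (\<chi> i j. vij i j) $ i $ j)"
    proof (rule sum_mult_psd_nonneg)
      show "0 \<le> w \<bullet> (a \<tau> y *v w)" for w
        using posdef unfolding positive_definite_def by (cases "w = 0") (auto simp: less_imp_le)
    qed (use test(2) posdef positive_definite_def in auto)
    also have "\<dots> = (\<Sum>i\<in>UNIV. \<Sum>j\<in>UNIV. a \<tau> y $ i $ j * fij \<tau> i j y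
        + (if i = j then 4 * E \<tau> * q \<tau> y * a \<tau> y $ i $ j else 0)
        - 8 * E \<tau> * (a \<tau> y $ i $ j * (y - x0) $ i * (y - x0) $ j))"
      by (intro sum.cong refl) (simp add: vij_def algebra_simps)
    also have "\<dots> = (\<Sum>i\<in>UNIV. \<Sum>j\<in>UNIV. a \<tau> y $ i $ j * fij \<tau> i j y)
        + 4 * E \<tau> * q \<tau> y * trace (a \<tau> y) - 8 * E \<tau> * ((y - x0) \<bullet> (a \<tau> y *v (y - x0)))"
      by (simp add: sum.distrib sum_subtractf trace_def inner_matrix_vector_mult
          flip: sum_distrib_left)
    finally have hess: "8 * E \<tau> * ((y - x0) \<bullet> (a \<tau> y *v (y - x0))) - 4 * E \<tau> * q \<tau> y * trace (a \<tau> y)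
        \<le> (\<Sum>i\<in>UNIV. \<Sum>j\<in>UNIV. a \<tau> y $ i $ j * fij \<tau> i j y)"
      by linarith
    have grad: "(\<Sum>k\<in>UNIV. b \<tau> y $ k * fj \<tau> k y) = - 4 * E \<tau> * q \<tau> y * (b \<tau> y \<bullet> (y - x0))"
      by (simp add: fj inner_vec_def sum_distrib_left mult_ac)
    define vt where "vt = ft \<tau> y - E \<tau> * (2 * q \<tau> y * m - K * (q \<tau> y)\<^sup>2)"
    have vt: "((\<lambda>\<sigma>. v \<sigma> y) has_real_derivative vt) (at \<tau>)"
    proof -
      define e0 where "e0 = c / (\<delta>\<^sup>2)\<^sup>2"
      have dE: "(E has_real_derivative - K * E \<tau>) (at \<tau>)"
        unfolding E_def[abs_def] e0_def[symmetric] by (auto intro!: derivative_eq_intros)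
      have dq': "((\<lambda>\<sigma>. q \<sigma> y) has_real_derivative m) (at \<tau>)"
        unfolding q_def by (auto intro!: derivative_eq_intros)
      show ?thesis
        unfolding v_def vt_def
        by (rule DERIV_cong[OF DERIV_diff[OF Dt[OF \<tau> y] DERIV_mult[OF dE DERIV_power[OF dq', of 2]]]])
          (simp add: algebra_simps)
    qed
    \<comment> \<open>The minimum may occur at the final time, so comparison is made with earlier
      times only. This yields a sign for the time derivative instead of its vanishing.\<close>
    have "vt \<le> 0"
    proof (rule ccontr)
      assume "\<not> vt \<le> 0"
      then obtain e where e: "0 < e" "\<And>h. 0 < h \<Longrightarrow> h < e \<Longrightarrow> v (\<tau> - h) y < v \<tau> y"
        using DERIV_pos_inc_left[OF vt] by auto
      \<comment> \<open>Going back by \<open>h\<close> lowers \<open>q\<close> by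
        \<open>m * h\<close>; the last two bounds keep the earlier point inside
        \<open>D\<close>.\<close>
      define h where "h = min (e / 2) (min (\<tau> - s) (q \<tau> y / m))"
      have h: "0 < h" "h < e" "h \<le> \<tau> - s" "h \<le> q \<tau> y / m"
        using e(1) \<open>s < \<tau>\<close> q m by (auto simp: h_def)
      have "q (\<tau> - h) y = q \<tau> y - m * h"
        by (simp add: q_def algebra_simps)
      then have "0 \<le> q (\<tau> - h) y"
        using h(4) m by (simp add: field_simps)
      then have "(\<tau> - h, y) \<in> D"
        using h \<tau> by (simp add: D)
      then have "v \<tau> y \<le> v (\<tau> - h) y"
        using z(2) by (force simp: \<tau>y)
      then show False
        using e(2)[OF h(1,2)] by simp
    qed
    \<comment> \<open>The time condition bounds \<open>ft\<close> above and the spatial conditions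
      bound the elliptic operator on \<open>f\<close> below. With \<open>super\<close> between them,
      the barrier would violate its strict subsolution inequality.\<close>
    have "0 \<le> E \<tau> * (F z - K * (q (fst z) (snd z))\<^sup>2)"
      using super[OF \<tau> y] hess grad \<open>vt \<le> 0\<close>
      by (simp add: vt_def F_def \<tau>y algebra_simps)
    moreover have "E \<tau> * (F z - K * (q (fst z) (snd z))\<^sup>2) < 0"
      using K[OF z(1)] E[of \<tau>] by (simp add: mult_pos_neg)
    ultimately show False by linarith
  qed
  have "(norm (x - x0))\<^sup>2 < r\<^sup>2"
    using r by (simp add: dist_norm norm_minus_commute power_strict_mono)
  then have "0 < q t x"
    by (simp add: qt power2_norm_eq_inner)
  moreover have "0 \<le> v t x"
    using v_nonneg[of t x] \<open>0 < q t x\<close> \<open>s < t\<close> D by simp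
  moreover have "0 < E t * (q t x)\<^sup>2"
    using E[of t] \<open>0 < q t x\<close> by simp
  ultimately show ?thesis
    by (simp add: v_def)
qed

section \<open>Calculus in charts\<close>

lemma chart_inv_chart_map:
  assumes "is_chart X \<kappa>" and "p \<in> chart_dom \<kappa>"
  shows "chart_inv \<kappa> (chart_map \<kappa> p) = p"
proof -
  have "chart_dom \<kappa> \<subseteq> topspace X"
    using assms(1) openin_subset by (auto simp: is_chart_def)
  then have "topspace (subtopology X (chart_dom \<kappa>)) = chart_dom \<kappa>"
    by auto
  then have "inj_on (chart_map \<kappa>) (chart_dom \<kappa>)"
    using assms(1) homeomorphic_imp_injective_map unfolding is_chart_def by metis
  then show ?thesis
    using assms(2) by (simp add: chart_inv_def)
qed

lemma chart_map_chart_inv: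
  assumes "x \<in> chart_map \<kappa> ` chart_dom \<kappa>"
  shows "chart_inv \<kappa> x \<in> chart_dom \<kappa>" and "chart_map \<kappa> (chart_inv \<kappa> x) = x"
  using assms by (simp_all add: chart_inv_def inv_into_into f_inv_into_f)

lemma openin_chart_preimage:
  assumes "is_chart X \<kappa>" and "open V"
  shows "openin X {p \<in> chart_dom \<kappa>. chart_map \<kappa> p \<in> V}"
proof -
  have dom: "openin X (chart_dom \<kappa>)" and
    cont: "continuous_map (subtopology X (chart_dom \<kappa>))
      (top_of_set (chart_map \<kappa> ` chart_dom \<kappa>)) (chart_map \<kappa>)"
    using assms(1) by (auto simp: is_chart_def homeomorphic_imp_continuous_map)
  have "continuous_map (subtopology X (chart_dom \<kappa>)) euclidean (chart_map \<kappa>)"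
    using cont continuous_map_in_subtopology by blast
  then have "openin (subtopology X (chart_dom \<kappa>))
      {p \<in> topspace (subtopology X (chart_dom \<kappa>)). chart_map \<kappa> p \<in> V}"
    by (rule openin_continuous_map_preimage) (use assms(2) in simp)
  then have "openin X {p \<in> topspace (subtopology X (chart_dom \<kappa>)). chart_map \<kappa> p \<in> V}"
    using dom by (rule openin_trans_full)
  moreover have "topspace (subtopology X (chart_dom \<kappa>)) = chart_dom \<kappa>"
    using openin_subset[OF dom] by auto
  ultimately show ?thesis
    by (simp only:)
qed

text \<open>Values of \<open>chart_inv\<close> off the chart image are arbitrary; since the image is
  open, they cannot affect the derivative.\<close>

lemma pd_eqI:
  assumes "is_chart X \<kappa>" and "p \<in> chart_dom \<kappa>"
    and "\<And>y. y \<in> chart_map \<kappa> ` chart_dom \<kappa> \<Longrightarrow> F (chart_inv \<kappa> y) = f y"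
    and "(f has_derivative D) (at (chart_map \<kappa> p))"
  shows "pd \<kappa> i F p = D (axis i 1)"
proof -
  have "open (chart_map \<kappa> ` chart_dom \<kappa>)"
    using assms(1) by (simp add: is_chart_def)
  then have "((F \<circ> chart_inv \<kappa>) has_derivative D) (at (chart_map \<kappa> p))"
    using assms(2,3) by (intro has_derivative_transform_within_open[OF assms(4)]) auto
  then show ?thesis
    unfolding pd_def by (metis frechet_derivative_at)
qed

lemma pd_const:
  assumes "is_chart X \<kappa>" and "p \<in> chart_dom \<kappa>" and "\<And>q. q \<in> chart_dom \<kappa> \<Longrightarrow> F q = c"
  shows "pd \<kappa> i F p = 0"
proof (rule pd_eqI[OF assms(1,2)])
  show "F (chart_inv \<kappa> y) = c" if "y \<in> chart_map \<kappa> ` chart_dom \<kappa>" for y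
    using assms(3)[OF chart_map_chart_inv(1)[OF that]] .
  show "((\<lambda>y. c) has_derivative (\<lambda>h. 0)) (at (chart_map \<kappa> p))"
    by simp
qed

text \<open>Taken from the joint derivative in \<open>(t, x)\<close> and not from a time slice, so
  the result is again jointly smooth and the operation can be iterated.\<close>

definition space_deriv :: "(real \<times> (real^'n) \<Rightarrow> real) \<Rightarrow> 'n \<Rightarrow> real \<times> (real^'n) \<Rightarrow> real" where
  "space_deriv f i z = frechet_derivative f (at z) (0, axis i 1)"

lemma Ck_on_space_deriv:
  "Ck_on (Suc k) S f \<Longrightarrow> Ck_on k S (space_deriv f i)"
  unfolding space_deriv_def[abs_def] by simp

lemma has_derivative_space:
  assumes "Ck_on (Suc k) S f" and "(t, x) \<in> S"
  shows "((\<lambda>y. f (t, y)) has_derivative (\<lambda>h. \<Sum>j\<in>UNIV. h $ j * space_deriv f j (t, x))) (at x)"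
proof -
  let ?D = "frechet_derivative f (at (t, x))"
  have D: "(f has_derivative ?D) (at (t, x))"
    using assms by (rule Ck_on_SucD(1))
  have "((\<lambda>y. (t, y)) has_derivative (\<lambda>h. (0, h))) (at x)"
    by (intro has_derivative_Pair has_derivative_const has_derivative_ident)
  then have "((\<lambda>y. f (t, y)) has_derivative (\<lambda>h. ?D (0, h))) (at x)"
    using D by (rule has_derivative_compose)
  moreover have "?D (0, h) = (\<Sum>j\<in>UNIV. h $ j * space_deriv f j (t, x))" for h
  proof -
    have lin: "linear (\<lambda>h. ?D (0, h))"
      using calculation by (rule has_derivative_linear)
    have "?D (0, h) = ?D (0, \<Sum>j\<in>UNIV. h $ j *\<^sub>R axis j 1)"
      using basis_expansion[of h] by (simp add: scalar_mult_eq_scaleR)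
    also have "\<dots> = (\<Sum>j\<in>UNIV. h $ j * ?D (0, axis j 1))"
      unfolding linear_sum[OF lin] linear_scale[OF lin] by simp
    finally show ?thesis
      by (simp add: space_deriv_def)
  qed
  ultimately show ?thesis by simp
qed

lemma has_vector_derivative_time:
  assumes "Ck_on (Suc k) S f" and "(t, x) \<in> S"
  shows "((\<lambda>s. f (s, x)) has_vector_derivative frechet_derivative f (at (t, x)) (1, 0)) (at t)"
proof -
  let ?D = "frechet_derivative f (at (t, x))"
  have D: "(f has_derivative ?D) (at (t, x))"
    using assms by (rule Ck_on_SucD(1))
  have "((\<lambda>s. (s, x)) has_derivative (\<lambda>h. (h, 0))) (at t)"
    by (intro has_derivative_Pair has_derivative_const has_derivative_ident)
  then have d: "((\<lambda>s. f (s, x)) has_derivative (\<lambda>h. ?D (h, 0))) (at t)"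
    using D by (rule has_derivative_compose)
  then have "linear (\<lambda>h. ?D (h, 0))"
    by (rule has_derivative_linear)
  then have "?D (h, 0) = h *\<^sub>R ?D (1, 0)" for h
    using linear_scale[of "\<lambda>h. ?D (h, 0)" h 1] by simp
  then have "(\<lambda>h. ?D (h, 0)) = (\<lambda>h. h *\<^sub>R ?D (1, 0))"
    by (rule ext)
  then show ?thesis
    using d by (simp only: has_vector_derivative_def)
qed

lemma has_real_derivative_matrix_entry:
  fixes M :: "real \<Rightarrow> real^'n^'m"
  assumes "(M has_vector_derivative M') (at t)"
  shows "((\<lambda>s. M s $ i $ j) has_real_derivative M' $ i $ j) (at t)"
  using bounded_linear.has_vector_derivative[OF
      bounded_linear_compose[OF bounded_linear_vec_nth bounded_linear_vec_nth] assms]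
  by (simp add: has_real_derivative_iff_has_vector_derivative)

text \<open>The derivative of the inverse \<open>P\<close> of \<open>G\<close> is obtained by differentiating \<open>P G = 1\<close>.\<close>

lemma has_real_derivative_trace_matrix_inv:
  fixes G h :: "real \<Rightarrow> real^'n^'n" and G' h' :: "real^'n^'n"
  defines "P \<equiv> \<lambda>s. matrix_inv (G s)"
  assumes G: "(G has_vector_derivative G') (at t)" and h: "(h has_vector_derivative h') (at t)"
    and "open S" and "t \<in> S" and inv: "\<And>s. s \<in> S \<Longrightarrow> invertible (G s)"
    and diff: "\<And>i j. \<exists>d. ((\<lambda>s. P s $ i $ j) has_real_derivative d) (at t)"
  shows "((\<lambda>s. \<Sum>i\<in>UNIV. \<Sum>j\<in>UNIV. P s $ i $ j * h s $ i $ j) has_real_derivative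
    (\<Sum>i\<in>UNIV. \<Sum>j\<in>UNIV. P t $ i $ j * h' $ i $ j) - trace (P t ** G' ** P t ** transpose (h t))) (at t)"
proof -
  obtain d where d: "\<And>i j. ((\<lambda>s. P s $ i $ j) has_real_derivative d i j) (at t)"
    using diff by metis
  define P' :: "real^'n^'n" where "P' = (\<chi> i j. d i j)"
  have P': "((\<lambda>s. P s $ i $ j) has_real_derivative P' $ i $ j) (at t)" for i j
    using d by (simp add: P'_def)
  note Gij = has_real_derivative_matrix_entry[OF G] and hij = has_real_derivative_matrix_entry[OF h]
  have "(P' ** G t + P t ** G') $ i $ j = 0" for i j
  proof -
    have "((\<lambda>s. \<Sum>k\<in>UNIV. P s $ i $ k * G s $ k $ j) has_real_derivative
        (\<Sum>k\<in>UNIV. P' $ i $ k * G t $ k $ j + G' $ k $ j * P t $ i $ k)) (at t)"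
      by (intro DERIV_sum DERIV_mult P' Gij)
    moreover have PG: "(\<Sum>k\<in>UNIV. P s $ i $ k * G s $ k $ j) = mat 1 $ i $ j" if "s \<in> S" for s
      using arg_cong[OF invertible_matrix_inv(2)[OF inv[OF that]], of "\<lambda>M. M $ i $ j"]
      by (simp add: P_def matrix_matrix_mult_def)
    ultimately have "((\<lambda>s. mat 1 $ i $ j :: real) has_real_derivative
        (\<Sum>k\<in>UNIV. P' $ i $ k * G t $ k $ j + G' $ k $ j * P t $ i $ k)) (at t)"
      by (rule has_field_derivative_transform_within_open[OF _ \<open>open S\<close> \<open>t \<in> S\<close>])
    then have "(\<Sum>k\<in>UNIV. P' $ i $ k * G t $ k $ j + G' $ k $ j * P t $ i $ k) = 0"
      using DERIV_const DERIV_unique by blast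
    then show ?thesis
      by (simp add: matrix_matrix_mult_def sum.distrib mult.commute)
  qed
  then have "P' ** G t + P t ** G' = 0"
    by (simp add: vec_eq_iff)
  moreover have distrib: "(A + B) ** C = A ** C + B ** C" for A B C :: "real^'n^'n"
    by (simp add: vec_eq_iff matrix_matrix_mult_def sum.distrib distrib_right)
  \<comment> \<open>Right multiplication by the inverse solves for \<open>P'\<close>, giving
    \<open>P' = - P G' P\<close>.\<close>
  ultimately have "(P' ** G t + P t ** G') ** P t = 0"
    by simp
  then have "P' + P t ** G' ** P t = 0"
    using invertible_matrix_inv(1)[OF inv[OF \<open>t \<in> S\<close>]]
    by (simp add: P_def matrix_mul_assoc[symmetric] distrib)
  then have P'_eq: "P' $ i $ j = - (P t ** G' ** P t) $ i $ j" for i j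
    by (simp add: eq_neg_iff_add_eq_0 vec_eq_iff)
  have "((\<lambda>s. \<Sum>i\<in>UNIV. \<Sum>j\<in>UNIV. P s $ i $ j * h s $ i $ j) has_real_derivative
      (\<Sum>i\<in>UNIV. \<Sum>j\<in>UNIV. P' $ i $ j * h t $ i $ j + h' $ i $ j * P t $ i $ j)) (at t)"
    by (intro DERIV_sum DERIV_mult P' hij)
  moreover have "trace (P t ** G' ** P t ** transpose (h t)) =
      (\<Sum>i\<in>UNIV. \<Sum>j\<in>UNIV. (P t ** G' ** P t) $ i $ j * h t $ i $ j)"
    by (simp add: trace_eq_sum_transpose)
  ultimately show ?thesis
    by (simp add: P'_eq sum.distrib sum_negf sum_subtractf mult.commute)
qed

lemma metric_trace_eq_trace:
  assumes "transpose (h \<kappa> p) = h \<kappa> p"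
  shows "metric_trace G h \<kappa> p = trace (matrix_inv (G \<kappa> p) ** h \<kappa> p)"
  unfolding trace_eq_sum_transpose assms by (simp add: metric_trace_def ginv_def)

section \<open>The strong minimum principle for the trace\<close>

locale flow_on_manifold =
  fixes X :: "'a topology" and \<A> :: "('a, 'n::finite) chart set"
    and T :: real and g \<alpha> :: "real \<Rightarrow> ('a, 'n) tensor2"
  assumes manifold: "smooth_manifold X \<A>"
    and flow: "geometric_flow \<A> T g \<alpha>"
begin

section \<open>Space-time coordinate expressions of the flow\<close>

definition W :: "('a, 'n) chart \<Rightarrow> (real \<times> (real^'n)) set" where
  "W \<kappa> = {0<..<T} \<times> chart_map \<kappa> ` chart_dom \<kappa>"

definition G :: "('a, 'n) chart \<Rightarrow> real \<times> (real^'n) \<Rightarrow> real^'n^'n" where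
  "G \<kappa> z = g (fst z) \<kappa> (chart_inv \<kappa> (snd z))"

definition P :: "('a, 'n) chart \<Rightarrow> real \<times> (real^'n) \<Rightarrow> real^'n^'n" where
  "P \<kappa> z = matrix_inv (G \<kappa> z)"

definition a :: "('a, 'n) chart \<Rightarrow> real \<times> (real^'n) \<Rightarrow> real^'n^'n" where
  "a \<kappa> z = \<alpha> (fst z) \<kappa> (chart_inv \<kappa> (snd z))"

definition u :: "('a, 'n) chart \<Rightarrow> real \<times> (real^'n) \<Rightarrow> real" where
  "u \<kappa> z = flow_A g \<alpha> (fst z) \<kappa> (chart_inv \<kappa> (snd z))"

text \<open>The Christoffel symbols written with joint derivatives, so that continuity in time and
  space together follows from smoothness of \<open>G\<close>.\<close>

definition Gamma :: "('a, 'n) chart \<Rightarrow> 'n \<Rightarrow> 'n \<Rightarrow> 'n \<Rightarrow> real \<times> (real^'n) \<Rightarrow> real" where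
  "Gamma \<kappa> k i j z = (1/2) * (\<Sum>l\<in>UNIV. P \<kappa> z $ k $ l *
     (space_deriv (\<lambda>z. G \<kappa> z $ j $ l) i z + space_deriv (\<lambda>z. G \<kappa> z $ i $ l) j z
      - space_deriv (\<lambda>z. G \<kappa> z $ i $ j) l z))"

lemma chart: "\<kappa> \<in> \<A> \<Longrightarrow> is_chart X \<kappa>"
  using manifold by (simp add: smooth_manifold_def)

lemma topspace_eq: "topspace X = (\<Union>\<kappa>\<in>\<A>. chart_dom \<kappa>)"
  using manifold by (simp add: smooth_manifold_def)

lemma chart_dom_subset: "\<kappa> \<in> \<A> \<Longrightarrow> p \<in> chart_dom \<kappa> \<Longrightarrow> p \<in> topspace X"
  unfolding topspace_eq by blast

lemma chart_around:
  assumes "p \<in> topspace X"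
  obtains \<kappa> where "\<kappa> \<in> \<A>" and "p \<in> chart_dom \<kappa>"
  using assms unfolding topspace_eq by blast

lemma open_W: "\<kappa> \<in> \<A> \<Longrightarrow> open (W \<kappa>)"
  using chart[of \<kappa>] by (simp add: W_def is_chart_def open_Times)

lemma positive_definite_metric:
  assumes "\<kappa> \<in> \<A>" and "t \<in> {0<..<T}" and "p \<in> chart_dom \<kappa>"
  shows "positive_definite (g t \<kappa> p)"
  using flow assms
  unfolding geometric_flow_def riemannian_metric_def sym_tensor_field_def positive_definite_def
  by blast

lemma transpose_flow:
  assumes "\<kappa> \<in> \<A>" and "t \<in> {0<..<T}" and "p \<in> chart_dom \<kappa>"
  shows "transpose (\<alpha> t \<kappa> p) = \<alpha> t \<kappa> p"
  using flow assms unfolding geometric_flow_def sym_tensor_field_def by blast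

lemma positive_definite_G: "\<kappa> \<in> \<A> \<Longrightarrow> z \<in> W \<kappa> \<Longrightarrow> positive_definite (G \<kappa> z)"
  unfolding G_def W_def
  by (rule positive_definite_metric) (auto intro: chart_map_chart_inv)

lemma positive_definite_P: "\<kappa> \<in> \<A> \<Longrightarrow> z \<in> W \<kappa> \<Longrightarrow> positive_definite (P \<kappa> z)"
  unfolding P_def by (intro positive_definite_matrix_inv positive_definite_G)

lemma Ck_G: "\<kappa> \<in> \<A> \<Longrightarrow> Ck_on k (W \<kappa>) (\<lambda>z. G \<kappa> z $ i $ j)"
  and Ck_a: "\<kappa> \<in> \<A> \<Longrightarrow> Ck_on k (W \<kappa>) (\<lambda>z. a \<kappa> z $ i $ j)"
  using flow open_W[of \<kappa>]
  by (auto simp: geometric_flow_def smooth_family_def smooth_on_def G_def a_def W_def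
      case_prod_unfold intro!: Ck_on_matrix_entry)

lemma Ck_P: "\<kappa> \<in> \<A> \<Longrightarrow> Ck_on k (W \<kappa>) (\<lambda>z. P \<kappa> z $ i $ j)"
  unfolding P_def
  by (intro Ck_on_matrix_inv open_W Ck_G positive_definite_invertible positive_definite_G)

lemma u_eq: "u \<kappa> z = (\<Sum>i\<in>UNIV. \<Sum>j\<in>UNIV. P \<kappa> z $ i $ j * a \<kappa> z $ i $ j)"
  by (simp add: u_def flow_A_def metric_trace_def ginv_def P_def G_def a_def)

lemma Ck_u: "\<kappa> \<in> \<A> \<Longrightarrow> Ck_on k (W \<kappa>) (u \<kappa>)"
  unfolding u_eq[abs_def] by (intro Ck_on_sum Ck_on_mult open_W Ck_P Ck_a)

lemma continuous_on_Gamma: "\<kappa> \<in> \<A> \<Longrightarrow> continuous_on (W \<kappa>) (Gamma \<kappa> k i j)"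
proof -
  assume \<kappa>: "\<kappa> \<in> \<A>"
  have "continuous_on (W \<kappa>) (\<lambda>z. P \<kappa> z $ i $ j)" for i j
    using Ck_P[OF \<kappa>, of 0] by simp
  moreover have "continuous_on (W \<kappa>) (space_deriv (\<lambda>z. G \<kappa> z $ i $ j) l)" for i j l
    using Ck_on_space_deriv[OF Ck_G[OF \<kappa>], of 0] by simp
  ultimately show ?thesis
    unfolding Gamma_def[abs_def]
    by (intro continuous_on_mult continuous_on_const continuous_on_sum continuous_on_add
        continuous_on_diff)
qed

text \<open>Passage from derivatives at a fixed time to joint ones. Agreement is asked on the whole
  slice, so the result for first derivatives can be fed back in for second derivatives.\<close>

lemma pd_eq_space_deriv:
  assumes \<kappa>: "\<kappa> \<in> \<A>" and tx: "(t, x) \<in> W \<kappa>" and f: "Ck_on (Suc 0) (W \<kappa>) f"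
    and F: "\<And>y. (t, y) \<in> W \<kappa> \<Longrightarrow> F (chart_inv \<kappa> y) = f (t, y)"
  shows "pd \<kappa> i F (chart_inv \<kappa> x) = space_deriv f i (t, x)"
proof -
  have x: "x \<in> chart_map \<kappa> ` chart_dom \<kappa>"
    using tx by (simp add: W_def)
  have "pd \<kappa> i F (chart_inv \<kappa> x) = (\<Sum>j\<in>UNIV. axis i 1 $ j * space_deriv f j (t, x))"
  proof (rule pd_eqI[OF chart[OF \<kappa>] chart_map_chart_inv(1)[OF x]])
    show "((\<lambda>y. f (t, y)) has_derivative (\<lambda>h. \<Sum>j\<in>UNIV. h $ j * space_deriv f j (t, x)))
        (at (chart_map \<kappa> (chart_inv \<kappa> x)))"
      unfolding chart_map_chart_inv(2)[OF x] by (rule has_derivative_space[OF f tx])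
    show "F (chart_inv \<kappa> y) = f (t, y)" if "y \<in> chart_map \<kappa> ` chart_dom \<kappa>" for y
      using that tx by (intro F) (simp add: W_def)
  qed
  then show ?thesis
    by (simp add: axis_def if_distrib if_distribR cong: if_cong)
qed

lemma christoffel_eq:
  assumes \<kappa>: "\<kappa> \<in> \<A>" and tx: "(t, x) \<in> W \<kappa>"
  shows "christoffel (g t) \<kappa> k i j (chart_inv \<kappa> x) = Gamma \<kappa> k i j (t, x)"
proof -
  have "pd \<kappa> i (\<lambda>q. g t \<kappa> q $ j $ l) (chart_inv \<kappa> x) = space_deriv (\<lambda>z. G \<kappa> z $ j $ l) i (t, x)"
    for i j l
    by (rule pd_eq_space_deriv[OF \<kappa> tx Ck_G[OF \<kappa>]]) (simp add: G_def)
  then show ?thesis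
    by (simp add: christoffel_def Gamma_def ginv_def P_def G_def)
qed

text \<open>Brings the Laplacian into the shape of second-order plus drift terms demanded by the
  parabolic comparison; the drift is minus the metric trace of the Christoffel symbols.\<close>

lemma laplacian_eq:
  assumes \<kappa>: "\<kappa> \<in> \<A>" and tx: "(t, x) \<in> W \<kappa>"
  shows "laplacian (g t) (flow_A g \<alpha> t) \<kappa> (chart_inv \<kappa> x) =
    (\<Sum>i\<in>UNIV. \<Sum>j\<in>UNIV. P \<kappa> (t, x) $ i $ j * space_deriv (space_deriv (u \<kappa>) j) i (t, x))
    + (\<Sum>k\<in>UNIV. - (\<Sum>i\<in>UNIV. \<Sum>j\<in>UNIV. P \<kappa> (t, x) $ i $ j * Gamma \<kappa> k i j (t, x))
        * space_deriv (u \<kappa>) k (t, x))"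
proof -
  have pd1: "pd \<kappa> j (flow_A g \<alpha> t \<kappa>) (chart_inv \<kappa> y) = space_deriv (u \<kappa>) j (t, y)"
    if "(t, y) \<in> W \<kappa>" for j y
    by (rule pd_eq_space_deriv[OF \<kappa> that Ck_u[OF \<kappa>]]) (simp add: u_def)
  have pd2: "pd \<kappa> i (pd \<kappa> j (flow_A g \<alpha> t \<kappa>)) (chart_inv \<kappa> x) =
      space_deriv (space_deriv (u \<kappa>) j) i (t, x)" for i j
    by (rule pd_eq_space_deriv[OF \<kappa> tx Ck_on_space_deriv[OF Ck_u[OF \<kappa>]] pd1])
  have "(\<Sum>i\<in>UNIV. \<Sum>j\<in>UNIV. P \<kappa> (t, x) $ i $ j *
      (\<Sum>k\<in>UNIV. Gamma \<kappa> k i j (t, x) * space_deriv (u \<kappa>) k (t, x))) =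
    (\<Sum>i\<in>UNIV. \<Sum>j\<in>UNIV. \<Sum>k\<in>UNIV. P \<kappa> (t, x) $ i $ j *
      Gamma \<kappa> k i j (t, x) * space_deriv (u \<kappa>) k (t, x))"
    by (simp add: sum_distrib_left mult.assoc)
  also have "\<dots> = (\<Sum>i\<in>UNIV. \<Sum>k\<in>UNIV. \<Sum>j\<in>UNIV. P \<kappa> (t, x) $ i $ j *
      Gamma \<kappa> k i j (t, x) * space_deriv (u \<kappa>) k (t, x))"
    by (intro sum.cong refl sum.swap)
  also have "\<dots> = (\<Sum>k\<in>UNIV. \<Sum>i\<in>UNIV. \<Sum>j\<in>UNIV. P \<kappa> (t, x) $ i $ j *
      Gamma \<kappa> k i j (t, x) * space_deriv (u \<kappa>) k (t, x))"
    by (rule sum.swap)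
  finally have swap: "(\<Sum>i\<in>UNIV. \<Sum>j\<in>UNIV. P \<kappa> (t, x) $ i $ j *
      (\<Sum>k\<in>UNIV. Gamma \<kappa> k i j (t, x) * space_deriv (u \<kappa>) k (t, x))) =
    (\<Sum>k\<in>UNIV. (\<Sum>i\<in>UNIV. \<Sum>j\<in>UNIV. P \<kappa> (t, x) $ i $ j *
      Gamma \<kappa> k i j (t, x)) * space_deriv (u \<kappa>) k (t, x))"
    by (simp add: sum_distrib_right)
  have "laplacian (g t) (flow_A g \<alpha> t) \<kappa> (chart_inv \<kappa> x) =
    (\<Sum>i\<in>UNIV. \<Sum>j\<in>UNIV. P \<kappa> (t, x) $ i $ j * (space_deriv (space_deriv (u \<kappa>) j) i (t, x)
      - (\<Sum>k\<in>UNIV. Gamma \<kappa> k i j (t, x) * space_deriv (u \<kappa>) k (t, x))))"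
    unfolding laplacian_def pd1[OF tx] pd2 christoffel_eq[OF \<kappa> tx] by (simp add: ginv_def P_def G_def)
  also have "\<dots> = (\<Sum>i\<in>UNIV. \<Sum>j\<in>UNIV. P \<kappa> (t, x) $ i $ j * space_deriv (space_deriv (u \<kappa>) j) i (t, x))
    - (\<Sum>i\<in>UNIV. \<Sum>j\<in>UNIV. P \<kappa> (t, x) $ i $ j *
      (\<Sum>k\<in>UNIV. Gamma \<kappa> k i j (t, x) * space_deriv (u \<kappa>) k (t, x)))"
    by (simp add: right_diff_distrib sum_subtractf)
  finally show ?thesis
    unfolding swap by (simp add: sum_negf)
qed

text \<open>The trace is \<open>|\<alpha>|\<^sup>2\<close> with respect to \<open>g(t)\<close>.\<close>

lemma evolution_A:
  assumes \<kappa>: "\<kappa> \<in> \<A>" and tx: "(t, x) \<in> W \<kappa>"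
  shows "((\<lambda>s. u \<kappa> (s, x)) has_real_derivative
    flow_B g \<alpha> t \<kappa> (chart_inv \<kappa> x)
    + 2 * trace (P \<kappa> (t, x) ** a \<kappa> (t, x) ** P \<kappa> (t, x) ** a \<kappa> (t, x))) (at t)"
proof -
  define p where "p = chart_inv \<kappa> x"
  have t: "t \<in> {0<..<T}" and p: "p \<in> chart_dom \<kappa>"
    using tx chart_map_chart_inv(1)[of x \<kappa>] by (auto simp: W_def p_def)
  have g': "((\<lambda>s. g s \<kappa> p) has_vector_derivative (-2) *\<^sub>R \<alpha> t \<kappa> p) (at t)"
    using flow t p \<kappa> unfolding geometric_flow_def by blast
  have "Ck_on (Suc 0) (W \<kappa>) (\<lambda>(s, y). \<alpha> s \<kappa> (chart_inv \<kappa> y))"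
    using flow \<kappa> unfolding geometric_flow_def smooth_family_def smooth_on_def W_def by blast
  from has_vector_derivative_time[OF this tx]
  have h': "((\<lambda>s. \<alpha> s \<kappa> p) has_vector_derivative time_deriv \<alpha> t \<kappa> p) (at t)"
    unfolding time_deriv_def
    by (simp add: p_def) (metis vector_derivative_works differentiableI_vector)
  \<comment> \<open>The minus sign from differentiating the inverse meets the factor -2 of the flow
    equation, whence the term with coefficient +2.\<close>
  have D: "((\<lambda>s. \<Sum>i\<in>UNIV. \<Sum>j\<in>UNIV. matrix_inv (g s \<kappa> p) $ i $ j * \<alpha> s \<kappa> p $ i $ j)
      has_real_derivative
      (\<Sum>i\<in>UNIV. \<Sum>j\<in>UNIV. matrix_inv (g t \<kappa> p) $ i $ j * time_deriv \<alpha> t \<kappa> p $ i $ j)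
      - trace (matrix_inv (g t \<kappa> p) ** ((-2) *\<^sub>R \<alpha> t \<kappa> p) ** matrix_inv (g t \<kappa> p)
          ** transpose (\<alpha> t \<kappa> p))) (at t)"
  proof (rule has_real_derivative_trace_matrix_inv[OF g' h' open_greaterThanLessThan t])
    show "invertible (g s \<kappa> p)" if "s \<in> {0<..<T}" for s
      using positive_definite_invertible positive_definite_metric[OF \<kappa> that p] .
    show "\<exists>d. ((\<lambda>s. matrix_inv (g s \<kappa> p) $ i $ j) has_real_derivative d) (at t)" for i j
      using has_vector_derivative_time[OF Ck_P[OF \<kappa>] tx, of i j]
      by (auto simp: P_def G_def p_def has_real_derivative_iff_has_vector_derivative)
  qed
  have "M ** (c *\<^sub>R N) ** M ** N = c *\<^sub>R (M ** N ** M ** N)" for c and M N :: "real^'n^'n"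
    by (simp add: matrix_scalar_ac scalar_matrix_assoc)
  moreover have "trace (c *\<^sub>R M) = c * trace M" for c and M :: "real^'n^'n"
    by (simp add: trace_def sum_distrib_left)
  ultimately have tr: "trace (matrix_inv (g t \<kappa> p) ** ((-2) *\<^sub>R \<alpha> t \<kappa> p) ** matrix_inv (g t \<kappa> p)
      ** transpose (\<alpha> t \<kappa> p))
    = (-2) * trace (matrix_inv (g t \<kappa> p) ** \<alpha> t \<kappa> p ** matrix_inv (g t \<kappa> p) ** \<alpha> t \<kappa> p)"
    unfolding transpose_flow[OF \<kappa> t p] by (simp only:)
  from D[unfolded tr] show ?thesis
    by (simp add: u_eq P_def G_def a_def flow_B_def metric_trace_def ginv_def flip: p_def)
qed

text \<open>Stated for two times and two points so that it covers both a change of charts and the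
  pullback by \<eta>.\<close>

lemma flow_A_congruence:
  assumes "\<kappa> \<in> \<A>" and "\<kappa>' \<in> \<A>" and "p \<in> chart_dom \<kappa>" and "q \<in> chart_dom \<kappa>'"
    and "s \<in> {0<..<T}" and "t \<in> {0<..<T}"
    and g: "g s \<kappa> p = transpose J ** g t \<kappa>' q ** J"
    and \<alpha>: "\<alpha> s \<kappa> p = transpose J ** \<alpha> t \<kappa>' q ** J"
  shows "flow_A g \<alpha> s \<kappa> p = flow_A g \<alpha> t \<kappa>' q"
proof -
  have inv: "invertible (g s \<kappa> p)" "invertible (g t \<kappa>' q)"
    using assms(1-6) by (blast intro: positive_definite_invertible positive_definite_metric)+
  have "flow_A g \<alpha> s \<kappa> p = trace (matrix_inv (g s \<kappa> p) ** \<alpha> s \<kappa> p)"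
    and "flow_A g \<alpha> t \<kappa>' q = trace (matrix_inv (g t \<kappa>' q) ** \<alpha> t \<kappa>' q)"
    using assms(1-6) by (simp_all only: flow_A_def metric_trace_eq_trace transpose_flow)
  then show ?thesis
    using trace_inverse_congruence[OF inv g] \<alpha> by simp
qed

text \<open>A genuine function on the manifold: \<open>flow_A\<close> carries a chart argument, here
  filled by an arbitrary chart around the point.\<close>

definition A :: "real \<Rightarrow> 'a \<Rightarrow> real" where
  "A t p = flow_A g \<alpha> t (SOME \<kappa>. \<kappa> \<in> \<A> \<and> p \<in> chart_dom \<kappa>) p"

lemma A_eq:
  assumes "\<kappa> \<in> \<A>" and "p \<in> chart_dom \<kappa>" and t: "t \<in> {0<..<T}"
  shows "A t p = flow_A g \<alpha> t \<kappa> p"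
proof -
  define \<kappa>' where "\<kappa>' = (SOME \<kappa>. \<kappa> \<in> \<A> \<and> p \<in> chart_dom \<kappa>)"
  have \<kappa>': "\<kappa>' \<in> \<A>" "p \<in> chart_dom \<kappa>'"
    using someI[of "\<lambda>\<kappa>. \<kappa> \<in> \<A> \<and> p \<in> chart_dom \<kappa>" \<kappa>] assms by (auto simp: \<kappa>'_def)
  have "sym_tensor_field \<A> (g t)" "sym_tensor_field \<A> (\<alpha> t)"
    using flow t unfolding geometric_flow_def riemannian_metric_def by auto
  then have "g t \<kappa>' p = pullback id (g t) \<kappa> \<kappa>' p" "\<alpha> t \<kappa>' p = pullback id (\<alpha> t) \<kappa> \<kappa>' p"
    using \<kappa>' assms unfolding sym_tensor_field_def by blast+
  then show ?thesis
    using flow_A_congruence[OF \<kappa>'(1) assms(1) \<kappa>'(2) assms(2) t t]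
    by (simp add: A_def \<kappa>'_def[symmetric] pullback_def)
qed

lemma u_eq_A:
  assumes "\<kappa> \<in> \<A>" and "(t, x) \<in> W \<kappa>"
  shows "u \<kappa> (t, x) = A t (chart_inv \<kappa> x)"
  using assms A_eq[OF assms(1)] chart_map_chart_inv(1)[of x \<kappa>] by (simp add: W_def u_def)

text \<open>Compactness is applied to the manifold alone: chart balls cover it, and over each one
  the minimum comes from a compact product with \<open>{s..t}\<close> in coordinates. The least of
  finitely many local minima is global.\<close>

lemma A_attains_inf:
  assumes "compact_space X" and "topspace X \<noteq> {}" and "s \<le> t" and st: "{s..t} \<subseteq> {0<..<T}"
  obtains \<tau> p where "\<tau> \<in> {s..t}" and "p \<in> topspace X"
    and "\<And>\<sigma> q. \<sigma> \<in> {s..t} \<Longrightarrow> q \<in> topspace X \<Longrightarrow> A \<tau> p \<le> A \<sigma> q"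
proof -
  \<comment> \<open>The minimiser \<open>r\<close> need not lie in \<open>N\<close>:
    \<open>N\<close> is an open chart ball, while the minimum is taken over the closed one.\<close>
  define good where "good N \<tau> r \<longleftrightarrow> \<tau> \<in> {s..t} \<and> r \<in> topspace X \<and>
    (\<forall>\<sigma>\<in>{s..t}. \<forall>q\<in>N. A \<tau> r \<le> A \<sigma> q)" for N \<tau> r
  define \<U> where "\<U> = {N. openin X N \<and> (\<exists>\<tau> r. good N \<tau> r)}"
  have "\<exists>N\<in>\<U>. p \<in> N" if "p \<in> topspace X" for p
  proof -
    obtain \<kappa> where \<kappa>: "\<kappa> \<in> \<A>" "p \<in> chart_dom \<kappa>"
      using \<open>p \<in> topspace X\<close> chart_around by blast
    have "open (chart_map \<kappa> ` chart_dom \<kappa>)"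
      using chart[OF \<kappa>(1)] by (simp add: is_chart_def)
    then obtain R where R: "0 < R" "cball (chart_map \<kappa> p) R \<subseteq> chart_map \<kappa> ` chart_dom \<kappa>"
      using \<kappa>(2) open_contains_cball by blast
    define K where "K = {s..t} \<times> cball (chart_map \<kappa> p) R"
    have K: "compact K" "K \<noteq> {}" and KW: "K \<subseteq> W \<kappa>"
      using \<open>s \<le> t\<close> R st by (auto simp: K_def W_def intro!: compact_Times)
    have "continuous_on K (u \<kappa>)"
      using Ck_u[OF \<kappa>(1), of 0] KW by (auto intro: continuous_on_subset)
    from continuous_attains_inf[OF K this]
    obtain z where z: "z \<in> K" "\<And>z'. z' \<in> K \<Longrightarrow> u \<kappa> z \<le> u \<kappa> z'"
      by blast
    obtain \<tau> y where zy: "z = (\<tau>, y)" by (cases z)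
    define N where "N = {q \<in> chart_dom \<kappa>. chart_map \<kappa> q \<in> ball (chart_map \<kappa> p) R}"
    have "good N \<tau> (chart_inv \<kappa> y)"
      unfolding good_def
    proof (intro conjI ballI)
      show "\<tau> \<in> {s..t}"
        using z(1) by (simp add: zy K_def)
      have y: "y \<in> chart_map \<kappa> ` chart_dom \<kappa>"
        using z(1) R(2) by (auto simp: zy K_def)
      show "chart_inv \<kappa> y \<in> topspace X"
        using chart_dom_subset[OF \<kappa>(1) chart_map_chart_inv(1)[OF y]] .
      fix \<sigma> q assume \<sigma>: "\<sigma> \<in> {s..t}" and q: "q \<in> N"
      have K\<sigma>: "(\<sigma>, chart_map \<kappa> q) \<in> K"
        using \<sigma> q by (simp add: K_def N_def)
      have "A \<tau> (chart_inv \<kappa> y) = u \<kappa> z"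
        using u_eq_A[OF \<kappa>(1)] z(1) KW by (auto simp: zy)
      also have "\<dots> \<le> u \<kappa> (\<sigma>, chart_map \<kappa> q)"
        using z(2)[OF K\<sigma>] .
      also have "\<dots> = A \<sigma> q"
        using u_eq_A[OF \<kappa>(1)] K\<sigma> KW chart_inv_chart_map[OF chart[OF \<kappa>(1)], of q] q
        by (auto simp: N_def)
      finally show "A \<tau> (chart_inv \<kappa> y) \<le> A \<sigma> q" .
    qed
    moreover have "openin X N"
      unfolding N_def by (rule openin_chart_preimage[OF chart[OF \<kappa>(1)] open_ball])
    moreover have "p \<in> N"
      using \<kappa>(2) R(1) by (simp add: N_def)
    ultimately show ?thesis
      by (auto simp: \<U>_def)
  qed
  then have "topspace X \<subseteq> \<Union>\<U>"
    by auto
  moreover have "\<forall>N\<in>\<U>. openin X N"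
    by (simp add: \<U>_def)
  ultimately obtain \<F> where \<F>: "finite \<F>" "\<F> \<subseteq> \<U>" "topspace X \<subseteq> \<Union>\<F>"
    using assms(1) unfolding compact_space_alt by meson
  have "\<forall>N\<in>\<F>. \<exists>z. good N (fst z) (snd z)"
    using \<F>(2) by (auto simp: \<U>_def)
  then obtain z where z: "\<And>N. N \<in> \<F> \<Longrightarrow> good N (fst (z N)) (snd (z N))"
    by metis
  have "\<F> \<noteq> {}"
    using \<F>(3) assms(2) by auto
  then obtain N where N: "N \<in> \<F>"
    "\<And>N'. N' \<in> \<F> \<Longrightarrow> A (fst (z N)) (snd (z N)) \<le> A (fst (z N')) (snd (z N'))"
    using ex_is_arg_min_if_finite[OF \<F>(1), of "\<lambda>N. A (fst (z N)) (snd (z N))"]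
    by (auto simp: is_arg_min_linorder)
  show thesis
  proof
    show "fst (z N) \<in> {s..t}" "snd (z N) \<in> topspace X"
      using z[OF N(1)] by (auto simp: good_def)
    show "A (fst (z N)) (snd (z N)) \<le> A \<sigma> q" if \<sigma>: "\<sigma> \<in> {s..t}" and q: "q \<in> topspace X" for \<sigma> q
    proof -
      obtain N' where "N' \<in> \<F>" "q \<in> N'"
        using q \<F>(3) by auto
      then have "A (fst (z N')) (snd (z N')) \<le> A \<sigma> q"
        using z[of N'] \<sigma> by (simp add: good_def)
      then show ?thesis
        using N(2)[OF \<open>N' \<in> \<F>\<close>] by linarith
    qed
  qed
qed

end

section \<open>Forward propagation of a strict lower bound for the trace\<close>

locale supersolution_flow = flow_on_manifold X \<A> T g \<alpha>
  for X :: "'a topology" and \<A> :: "('a, 'n::finite) chart set" and T g \<alpha> +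
  assumes B_minus_Lap_nonneg:
    "\<And>t \<kappa> p. t \<in> {0<..<T} \<Longrightarrow> \<kappa> \<in> \<A> \<Longrightarrow> p \<in> chart_dom \<kappa> \<Longrightarrow> 0 \<le> B_minus_Lap_A g \<alpha> t \<kappa> p"
begin

text \<open>The comparison is applied to \<open>u - m\<close> with the inverse metric as leading
  coefficient. The inequality \<open>super\<close> holds because \<open>B - \<Delta>A\<close> and
  the squared norm of \<alpha> are nonnegative.\<close>

lemma chart_strong_minimum:
  assumes \<kappa>: "\<kappa> \<in> \<A>" and "s < t" and st: "{s..t} \<subseteq> {0<..<T}"
    and R: "cball x0 R \<subseteq> chart_map \<kappa> ` chart_dom \<kappa>"
    and m: "\<And>\<tau> x. \<tau> \<in> {s..t} \<Longrightarrow> x \<in> cball x0 R \<Longrightarrow> m \<le> u \<kappa> (\<tau>, x)"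
    and "m < u \<kappa> (s, x0)" and "x \<in> ball x0 R"
  shows "m < u \<kappa> (t, x)"
proof -
  have sub: "{s..t} \<times> cball x0 R \<subseteq> W \<kappa>"
    using st R by (auto simp: W_def)
  have W: "(\<tau>, x) \<in> W \<kappa>" if "\<tau> \<in> {s..t}" "x \<in> ball x0 R" for \<tau> x
    using sub that ball_subset_cball by blast
  have contP: "continuous_on ({s..t} \<times> cball x0 R) (\<lambda>z. P \<kappa> z $ i $ j)" for i j
    using Ck_P[OF \<kappa>, of 0] sub by (auto intro: continuous_on_subset)
  have contG: "continuous_on ({s..t} \<times> cball x0 R) (Gamma \<kappa> k i j)" for k i j
    using continuous_on_Gamma[OF \<kappa>] sub by (auto intro: continuous_on_subset)
  have "0 < u \<kappa> (t, x) - m"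
  proof (rule parabolic_positivity_spreads[where f = "\<lambda>\<tau> x. u \<kappa> (\<tau>, x) - m"
        and fj = "\<lambda>\<tau> j x. space_deriv (u \<kappa>) j (\<tau>, x)"
        and fij = "\<lambda>\<tau> i j x. space_deriv (space_deriv (u \<kappa>) j) i (\<tau>, x)"
        and ft = "\<lambda>\<tau> x. flow_B g \<alpha> \<tau> \<kappa> (chart_inv \<kappa> x)
          + 2 * trace (P \<kappa> (\<tau>, x) ** a \<kappa> (\<tau>, x) ** P \<kappa> (\<tau>, x) ** a \<kappa> (\<tau>, x))"
        and a = "\<lambda>\<tau> x. P \<kappa> (\<tau>, x)"
        and b = "\<lambda>\<tau> x. \<chi> k. - (\<Sum>i\<in>UNIV. \<Sum>j\<in>UNIV. P \<kappa> (\<tau>, x) $ i $ j * Gamma \<kappa> k i j (\<tau>, x))"])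
    show "s < t" "0 < u \<kappa> (s, x0) - m" "x \<in> ball x0 R"
      using assms by auto
    show "continuous_on ({s..t} \<times> cball x0 R) (\<lambda>z. u \<kappa> (fst z, snd z) - m)"
      using Ck_u[OF \<kappa>, of 0] sub by (auto intro!: continuous_intros intro: continuous_on_subset)
    have "continuous_on ({s..t} \<times> cball x0 R) (\<lambda>z. \<chi> i j. P \<kappa> z $ i $ j)"
      by (intro continuous_on_vec_lambda contP)
    then show "continuous_on ({s..t} \<times> cball x0 R) (\<lambda>z. P \<kappa> (fst z, snd z))"
      by simp
    have "continuous_on ({s..t} \<times> cball x0 R)
        (\<lambda>z. \<chi> k. - (\<Sum>i\<in>UNIV. \<Sum>j\<in>UNIV. P \<kappa> z $ i $ j * Gamma \<kappa> k i j z))"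
      by (intro continuous_on_vec_lambda continuous_on_minus continuous_on_sum
          continuous_on_mult contP contG)
    then show "continuous_on ({s..t} \<times> cball x0 R) (\<lambda>z. \<chi> k. - (\<Sum>i\<in>UNIV. \<Sum>j\<in>UNIV.
        P \<kappa> (fst z, snd z) $ i $ j * Gamma \<kappa> k i j (fst z, snd z)))"
      by simp
    show "positive_definite (P \<kappa> (\<tau>, x))" if "\<tau> \<in> {s..t}" "x \<in> cball x0 R" for \<tau> x
      using positive_definite_P[OF \<kappa>] sub that by blast
    show "0 \<le> u \<kappa> (\<tau>, x) - m" if "\<tau> \<in> {s..t}" "x \<in> cball x0 R" for \<tau> x
      using m[OF that] by simp
    fix \<tau> x assume \<tau>x: "\<tau> \<in> {s..t}" "x \<in> ball x0 R"
    show "((\<lambda>\<sigma>. u \<kappa> (\<sigma>, x) - m) has_real_derivative flow_B g \<alpha> \<tau> \<kappa> (chart_inv \<kappa> x)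
          + 2 * trace (P \<kappa> (\<tau>, x) ** a \<kappa> (\<tau>, x) ** P \<kappa> (\<tau>, x) ** a \<kappa> (\<tau>, x))) (at \<tau>)"
      using DERIV_diff[OF evolution_A[OF \<kappa> W[OF \<tau>x]] DERIV_const[of m]] by simp
    show "((\<lambda>x. u \<kappa> (\<tau>, x) - m) has_derivative
        (\<lambda>h. \<Sum>j\<in>UNIV. h $ j * space_deriv (u \<kappa>) j (\<tau>, x))) (at x)"
      using has_derivative_diff[OF has_derivative_space[OF Ck_u[OF \<kappa>] W[OF \<tau>x]]
          has_derivative_const[of m]] by simp
    show "((\<lambda>x. space_deriv (u \<kappa>) j (\<tau>, x)) has_derivative
        (\<lambda>h. \<Sum>i\<in>UNIV. h $ i * space_deriv (space_deriv (u \<kappa>) j) i (\<tau>, x))) (at x)" for j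
      by (rule has_derivative_space[OF Ck_on_space_deriv[OF Ck_u[OF \<kappa>]] W[OF \<tau>x]])
    have dom: "chart_inv \<kappa> x \<in> chart_dom \<kappa>" "\<tau> \<in> {0<..<T}"
      using W[OF \<tau>x] chart_map_chart_inv(1)[of x \<kappa>] by (auto simp: W_def)
    have "0 \<le> trace (P \<kappa> (\<tau>, x) ** a \<kappa> (\<tau>, x) ** P \<kappa> (\<tau>, x) ** a \<kappa> (\<tau>, x))"
      using trace_square_nonneg(1)[OF positive_definite_P[OF \<kappa> W[OF \<tau>x]]]
        transpose_flow[OF \<kappa> dom(2,1)] by (simp add: a_def)
    moreover have "laplacian (g \<tau>) (flow_A g \<alpha> \<tau>) \<kappa> (chart_inv \<kappa> x) \<le> flow_B g \<alpha> \<tau> \<kappa> (chart_inv \<kappa> x)"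
      using B_minus_Lap_nonneg[OF dom(2) \<kappa> dom(1)] by (simp add: B_minus_Lap_A_def)
    ultimately show "(\<Sum>i\<in>UNIV. \<Sum>j\<in>UNIV.
          P \<kappa> (\<tau>, x) $ i $ j * space_deriv (space_deriv (u \<kappa>) j) i (\<tau>, x))
        + (\<Sum>k\<in>UNIV. (\<chi> k. - (\<Sum>i\<in>UNIV. \<Sum>j\<in>UNIV. P \<kappa> (\<tau>, x) $ i $ j * Gamma \<kappa> k i j (\<tau>, x))) $ k
            * space_deriv (u \<kappa>) k (\<tau>, x))
        \<le> flow_B g \<alpha> \<tau> \<kappa> (chart_inv \<kappa> x)
          + 2 * trace (P \<kappa> (\<tau>, x) ** a \<kappa> (\<tau>, x) ** P \<kappa> (\<tau>, x) ** a \<kappa> (\<tau>, x))"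
      unfolding vec_lambda_beta laplacian_eq[OF \<kappa> W[OF \<tau>x], symmetric] by linarith
  qed
  then show ?thesis by simp
qed

text \<open>The points where the bound is strict at every time after \<open>s\<close> form a clopen
  set. Time \<open>s\<close> itself is excluded from the definition of \<open>S\<close>, since
  strictness there is known only at \<open>p\<close>.\<close>

lemma strong_minimum:
  assumes "connected_space X" and "s < t" and st: "{s..t} \<subseteq> {0<..<T}"
    and m: "\<And>\<tau> q. \<tau> \<in> {s..t} \<Longrightarrow> q \<in> topspace X \<Longrightarrow> m \<le> A \<tau> q"
    and p: "p \<in> topspace X" and "m < A s p" and "q \<in> topspace X"
  shows "m < A t q"
proof -
  define S where "S = {p \<in> topspace X. \<forall>\<tau>\<in>{s<..t}. m < A \<tau> p}"
  \<comment> \<open>No minimal waiting time between \<tau> and \<tau>' enters, so crossing from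
    chart to chart costs no time.\<close>
  have spread: "m < A \<tau>' (chart_inv \<kappa> z)"
    if "\<kappa> \<in> \<A>" "cball y R \<subseteq> chart_map \<kappa> ` chart_dom \<kappa>" "z \<in> ball y R"
      "s \<le> \<tau>" "\<tau> < \<tau>'" "\<tau>' \<le> t" "m < A \<tau> (chart_inv \<kappa> y)" for \<kappa> y z R \<tau> \<tau>'
  proof -
    have y: "y \<in> cball y R"
      using that(3) by (auto intro: order.trans[OF zero_le_dist less_imp_le])
    have W: "(\<sigma>, x) \<in> W \<kappa>" if "\<sigma> \<in> {s..t}" "x \<in> cball y R" for \<sigma> x
      using that st \<open>cball y R \<subseteq> _\<close> by (auto simp: W_def)
    have "m < u \<kappa> (\<tau>', z)"
    proof (rule chart_strong_minimum[OF that(1) that(5) _ that(2) _ _ that(3)])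
      show "{\<tau>..\<tau>'} \<subseteq> {0<..<T}"
        using that(4,6) st by auto
      show "m < u \<kappa> (\<tau>, y)"
        using u_eq_A[OF that(1) W] that(4-7) y by simp
      show "m \<le> u \<kappa> (\<sigma>, x)" if "\<sigma> \<in> {\<tau>..\<tau>'}" "x \<in> cball y R" for \<sigma> x
      proof -
        have \<sigma>: "\<sigma> \<in> {s..t}"
          using that \<open>s \<le> \<tau>\<close> \<open>\<tau>' \<le> t\<close> by auto
        have "chart_inv \<kappa> x \<in> topspace X"
          using chart_map_chart_inv(1)[of x \<kappa>] that(2) \<open>cball y R \<subseteq> _\<close> \<open>\<kappa> \<in> \<A>\<close>
            chart_dom_subset by blast
        then show ?thesis
          using u_eq_A[OF \<open>\<kappa> \<in> \<A>\<close> W[OF \<sigma> that(2)]] m[OF \<sigma>] by simp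
      qed
    qed
    moreover have "z \<in> cball y R"
      using that(3) ball_subset_cball by blast
    ultimately show ?thesis
      using u_eq_A[OF that(1) W, of \<tau>' z] that(4-6) by simp
  qed
  \<comment> \<open>Within \<open>N\<close>, membership in \<open>S\<close> of one point forces it
    for all. This yields openness of \<open>S\<close> and of its complement at once.\<close>
  have local: "\<exists>N. openin X N \<and> p \<in> N \<and> (\<forall>y\<in>N. \<forall>z\<in>N. y \<in> S \<longrightarrow> z \<in> S)"
    if p: "p \<in> topspace X" for p
  proof -
    obtain \<kappa> where \<kappa>: "\<kappa> \<in> \<A>" "p \<in> chart_dom \<kappa>"
      using p chart_around by blast
    note inv = chart_inv_chart_map[OF chart[OF \<kappa>(1)]]
    have "open (chart_map \<kappa> ` chart_dom \<kappa>)"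
      using chart[OF \<kappa>(1)] by (simp add: is_chart_def)
    then obtain R where R: "0 < R" "cball (chart_map \<kappa> p) R \<subseteq> chart_map \<kappa> ` chart_dom \<kappa>"
      using \<kappa>(2) open_contains_cball by blast
    \<comment> \<open>With \<open>R / 3\<close>, the ball of radius \<open>2 * R / 3\<close> about
      any point of \<open>N\<close> contains all of \<open>N\<close> in coordinates and remains
      inside the chart.\<close>
    define N where "N = {q \<in> chart_dom \<kappa>. chart_map \<kappa> q \<in> ball (chart_map \<kappa> p) (R / 3)}"
    have "z \<in> S" if "y \<in> N" "z \<in> N" "y \<in> S" for y z
    proof -
      have "cball (chart_map \<kappa> y) (2 * R / 3) \<subseteq> cball (chart_map \<kappa> p) R"
      proof
        fix x assume "x \<in> cball (chart_map \<kappa> y) (2 * R / 3)"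
        then show "x \<in> cball (chart_map \<kappa> p) R"
          using that(1) dist_triangle[of "chart_map \<kappa> p" x "chart_map \<kappa> y"] by (simp add: N_def)
      qed
      then have sub: "cball (chart_map \<kappa> y) (2 * R / 3) \<subseteq> chart_map \<kappa> ` chart_dom \<kappa>"
        using R(2) by blast
      have z: "chart_map \<kappa> z \<in> ball (chart_map \<kappa> y) (2 * R / 3)"
        using that(1,2) dist_triangle[of "chart_map \<kappa> y" "chart_map \<kappa> z" "chart_map \<kappa> p"]
        by (simp add: N_def dist_commute)
      have "m < A \<tau> z" if "\<tau> \<in> {s<..t}" for \<tau>
      proof -
        \<comment> \<open>An intermediate time: strictness at \<open>y\<close> is available there,
          and the remaining time suffices to reach \<open>z\<close>.\<close>
        define \<tau>0 where "\<tau>0 = (s + \<tau>) / 2"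
        have "\<tau>0 \<in> {s<..t}" "s \<le> \<tau>0" "\<tau>0 < \<tau>" "\<tau> \<le> t"
          using that by (auto simp: \<tau>0_def)
        moreover have "m < A \<tau>0 (chart_inv \<kappa> (chart_map \<kappa> y))"
          using \<open>y \<in> S\<close> \<open>y \<in> N\<close> inv[of y] calculation(1) by (simp add: S_def N_def)
        ultimately have "m < A \<tau> (chart_inv \<kappa> (chart_map \<kappa> z))"
          using spread[OF \<kappa>(1) sub z] by blast
        then show ?thesis
          using inv[of z] \<open>z \<in> N\<close> by (simp add: N_def)
      qed
      moreover have "z \<in> topspace X"
        using \<open>z \<in> N\<close> chart_dom_subset[OF \<kappa>(1)] by (simp add: N_def)
      ultimately show ?thesis
        by (simp add: S_def)
    qed
    moreover have "openin X N"
      unfolding N_def by (rule openin_chart_preimage[OF chart[OF \<kappa>(1)] open_ball])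
    moreover have "p \<in> N"
      using \<kappa>(2) R(1) by (simp add: N_def)
    ultimately show ?thesis
      by blast
  qed
  have sub: "S \<subseteq> topspace X"
    by (auto simp: S_def)
  have "openin X S"
    unfolding openin_subopen[of X S]
  proof
    fix p assume "p \<in> S"
    then show "\<exists>N. openin X N \<and> p \<in> N \<and> N \<subseteq> S"
      using local[of p] sub by blast
  qed
  moreover have "openin X (topspace X - S)"
    unfolding openin_subopen[of X "topspace X - S"]
  proof
    fix p assume p: "p \<in> topspace X - S"
    then obtain N where N: "openin X N" "p \<in> N" "\<forall>y\<in>N. \<forall>z\<in>N. y \<in> S \<longrightarrow> z \<in> S"
      using local[of p] by blast
    then have "N \<subseteq> topspace X - S"
      using p openin_subset[OF N(1)] by blast
    then show "\<exists>N. openin X N \<and> p \<in> N \<and> N \<subseteq> topspace X - S"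
      using N by blast
  qed
  ultimately have "S = {} \<or> S = topspace X"
    using assms(1) sub unfolding connected_space_clopen_in closedin_def by blast
  moreover have "p \<in> S"
  proof -
    obtain \<kappa> where \<kappa>: "\<kappa> \<in> \<A>" "p \<in> chart_dom \<kappa>"
      using p chart_around by blast
    note inv = chart_inv_chart_map[OF chart[OF \<kappa>(1)] \<kappa>(2)]
    have "open (chart_map \<kappa> ` chart_dom \<kappa>)"
      using chart[OF \<kappa>(1)] by (simp add: is_chart_def)
    then obtain R where R: "0 < R" "cball (chart_map \<kappa> p) R \<subseteq> chart_map \<kappa> ` chart_dom \<kappa>"
      using \<kappa>(2) open_contains_cball by blast
    have "m < A \<tau> p" if "\<tau> \<in> {s<..t}" for \<tau>
      using spread[OF \<kappa>(1) R(2), of "chart_map \<kappa> p" s \<tau>] R(1) that \<open>m < A s p\<close> by (simp add: inv)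
    then show ?thesis
      using p by (simp add: S_def)
  qed
  ultimately have "q \<in> S"
    using assms by blast
  then show ?thesis
    using \<open>s < t\<close> by (simp add: S_def)
qed

text \<open>Constancy in space removes the Laplacian, so \<open>B\<close> alone is nonnegative;
  constancy in time makes \<open>B\<close> plus twice the squared norm of \<alpha> vanish.\<close>

lemma constant_A_imp_flat:
  assumes "s < t" and st: "{s..t} \<subseteq> {0<..<T}"
    and const: "\<And>\<tau> q. \<tau> \<in> {s..t} \<Longrightarrow> q \<in> topspace X \<Longrightarrow> A \<tau> q = m"
    and \<tau>: "\<tau> \<in> {s..t}" and \<kappa>: "\<kappa> \<in> \<A>" and p: "p \<in> chart_dom \<kappa>"
  shows "B_minus_Lap_A g \<alpha> \<tau> \<kappa> p = 0" and "\<alpha> \<tau> \<kappa> p = 0"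
proof -
  define x where "x = chart_map \<kappa> p"
  have px: "chart_inv \<kappa> x = p"
    unfolding x_def by (rule chart_inv_chart_map[OF chart[OF \<kappa>] p])
  have W: "(\<sigma>, x) \<in> W \<kappa>" if "\<sigma> \<in> {s..t}" for \<sigma>
    using that st p by (auto simp: W_def x_def)
  have pX: "q \<in> topspace X" if "q \<in> chart_dom \<kappa>" for q
    using that chart_dom_subset[OF \<kappa>] by blast
  define N where "N = trace (P \<kappa> (\<tau>, x) ** a \<kappa> (\<tau>, x) ** P \<kappa> (\<tau>, x) ** a \<kappa> (\<tau>, x))"
  have "flow_A g \<alpha> \<tau> \<kappa> q = m" if "q \<in> chart_dom \<kappa>" for q
    using A_eq[OF \<kappa> that, of \<tau>] const[OF \<tau> pX[OF that]] \<tau> st by auto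
  then have pd: "pd \<kappa> j (flow_A g \<alpha> \<tau> \<kappa>) q = 0" if "q \<in> chart_dom \<kappa>" for j q
    using pd_const[OF chart[OF \<kappa>] that] by blast
  then have "pd \<kappa> i (pd \<kappa> j (flow_A g \<alpha> \<tau> \<kappa>)) p = 0" for i j
    using pd_const[OF chart[OF \<kappa>] p] by blast
  then have lap: "laplacian (g \<tau>) (flow_A g \<alpha> \<tau>) \<kappa> p = 0"
    using pd[OF p] by (simp add: laplacian_def)
  \<comment> \<open>Constancy is known only on \<open>{s..t}\<close>; derivatives within the closed
    interval remain unique at its endpoints.\<close>
  have "((\<lambda>\<sigma>. u \<kappa> (\<sigma>, x)) has_vector_derivative (flow_B g \<alpha> \<tau> \<kappa> p + 2 * N)) (at \<tau> within cbox s t)"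
    using evolution_A[OF \<kappa> W[OF \<tau>]] has_vector_derivative_at_within
    by (auto simp: N_def px has_real_derivative_iff_has_vector_derivative)
  moreover have "((\<lambda>\<sigma>. u \<kappa> (\<sigma>, x)) has_vector_derivative 0) (at \<tau> within cbox s t)"
  proof (rule has_vector_derivative_transform[of \<tau> "cbox s t" _ "\<lambda>\<sigma>. m"])
    show "u \<kappa> (\<sigma>, x) = m" if "\<sigma> \<in> cbox s t" for \<sigma>
      using that u_eq_A[OF \<kappa> W] const pX[OF p] by (simp add: px)
  qed (use \<tau> in auto)
  ultimately have "flow_B g \<alpha> \<tau> \<kappa> p + 2 * N = 0"
    using vector_derivative_unique_within_closed_interval[OF \<open>s < t\<close>] \<tau> by auto
  moreover have \<tau>T: "\<tau> \<in> {0<..<T}"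
    using \<tau> st by auto
  have sym: "transpose (a \<kappa> (\<tau>, x)) = a \<kappa> (\<tau>, x)"
    using transpose_flow[OF \<kappa> \<tau>T p] by (simp add: a_def px)
  note sq = trace_square_nonneg[OF positive_definite_P[OF \<kappa> W[OF \<tau>]] sym, folded N_def]
  have "0 \<le> flow_B g \<alpha> \<tau> \<kappa> p"
    using B_minus_Lap_nonneg[OF \<tau>T \<kappa> p] lap by (simp add: B_minus_Lap_A_def)
  ultimately have "flow_B g \<alpha> \<tau> \<kappa> p = 0" "N = 0"
    using sq(1) by linarith+
  then show "B_minus_Lap_A g \<alpha> \<tau> \<kappa> p = 0" "\<alpha> \<tau> \<kappa> p = 0"
    using sq(2) lap by (simp_all add: B_minus_Lap_A_def a_def px)
qed

end

section \<open>Rigidity of steady breathers\<close>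

theorem corollary4p3:
  fixes X :: "'a topology" and \<A> :: "('a, 'n::finite) chart set"
    and T t1 t2 :: real and g \<alpha> :: "real \<Rightarrow> ('a, 'n) tensor2" and \<eta> :: "'a \<Rightarrow> 'a"
  assumes "smooth_manifold X \<A>" and "compact_space X" and "connected_space X"
    and "0 < T"
    and "geometric_flow \<A> T g \<alpha>"
    and "steady_breather X \<A> T g \<alpha> \<eta> t1 t2"
    and "Theta_nonneg \<A> T g \<alpha>"
    and "\<forall>t\<in>{0<..<T}. \<forall>\<kappa>\<in>\<A>. \<forall>p\<in>chart_dom \<kappa>. 0 \<le> B_minus_Lap_A g \<alpha> t \<kappa> p"
  shows "\<forall>t\<in>{t1..t2}. \<forall>\<kappa>\<in>\<A>. \<forall>p\<in>chart_dom \<kappa>.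
           B_minus_Lap_A g \<alpha> t \<kappa> p = 0 \<and> \<alpha> t \<kappa> p = 0"
\<comment> \<open>Compactness and connectedness do not exclude the empty space, where no minimum
  exists.\<close>
proof (cases "topspace X = {}")
  case True
  then have "chart_dom \<kappa> = {}" if "\<kappa> \<in> \<A>" for \<kappa>
    using assms(1) that by (auto simp: smooth_manifold_def)
  then show ?thesis by simp
next
  case False
  interpret supersolution_flow X \<A> T g \<alpha>
    by unfold_locales (use assms in auto)
  have t12: "0 < t1" "t1 < t2" "t2 < T" and "diffeomorphism X \<A> \<eta>"
    and breather: "\<And>\<kappa> \<kappa>' p. \<kappa> \<in> \<A> \<Longrightarrow> \<kappa>' \<in> \<A> \<Longrightarrow> p \<in> chart_dom \<kappa> \<Longrightarrow> \<eta> p \<in> chart_dom \<kappa>' \<Longrightarrow>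
      g t2 \<kappa> p = pullback \<eta> (g t1) \<kappa>' \<kappa> p \<and> \<alpha> t2 \<kappa> p = pullback \<eta> (\<alpha> t1) \<kappa>' \<kappa> p"
    using assms(6) by (auto simp: breather_def)
  then obtain \<eta>' where \<eta>: "homeomorphic_maps X X \<eta> \<eta>'"
    by (auto simp: diffeomorphism_def)
  then have \<eta>X: "\<eta> p \<in> topspace X" "\<eta>' p \<in> topspace X" "\<eta> (\<eta>' p) = p" if "p \<in> topspace X" for p
    using that by (auto simp: homeomorphic_maps_def continuous_map_def)
  have st: "{t1..t2} \<subseteq> {0<..<T}"
    using t12 by auto
  have A_\<eta>: "A t2 p = A t1 (\<eta> p)" if p: "p \<in> topspace X" for p
  proof -
    obtain \<kappa> \<kappa>' where \<kappa>: "\<kappa> \<in> \<A>" "p \<in> chart_dom \<kappa>" "\<kappa>' \<in> \<A>" "\<eta> p \<in> chart_dom \<kappa>'"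
      using p \<eta>X(1)[OF p] chart_around by metis
    have "flow_A g \<alpha> t2 \<kappa> p = flow_A g \<alpha> t1 \<kappa>' (\<eta> p)"
      using breather[OF \<kappa>(1,3,2,4)] t12
      by (intro flow_A_congruence[OF \<kappa>(1,3,2,4)]) (auto simp: pullback_def)
    then show ?thesis
      using A_eq[OF \<kappa>(1,2), of t2] A_eq[OF \<kappa>(3,4), of t1] t12 by simp
  qed
  obtain \<tau> p where \<tau>: "\<tau> \<in> {t1..t2}" and p: "p \<in> topspace X"
    and min: "\<And>\<sigma> q. \<sigma> \<in> {t1..t2} \<Longrightarrow> q \<in> topspace X \<Longrightarrow> A \<tau> p \<le> A \<sigma> q"
    using A_attains_inf[OF assms(2) False _ st] t12 by auto
  define m where "m = A \<tau> p"
  \<comment> \<open>Otherwise the excess at the same point would persist and contradict the minimum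
    at the later time \<tau>.\<close>
  have "A t1 p = m"
  proof (rule ccontr)
    assume "A t1 p \<noteq> m"
    then have "m < A t1 p"
      using min[of t1 p] t12 p by (simp add: m_def)
    moreover from this have "t1 < \<tau>"
      using \<tau> by (cases "\<tau> = t1") (auto simp: m_def)
    ultimately have "m < A \<tau> p"
      using \<tau> st min p by (intro strong_minimum[OF assms(3), of t1 \<tau> m p p]) (auto simp: m_def)
    then show False by (simp add: m_def)
  qed
  then have end_min: "A t2 (\<eta>' p) = m"
    using A_\<eta> \<eta>X p by simp
  \<comment> \<open>The propagation needs a strictly later time, so \<open>t2\<close> is left out;
    it is recovered from time \<open>t1\<close> through \<eta>.\<close>
  have before: "A \<sigma> q = m" if "\<sigma> \<in> {t1..<t2}" "q \<in> topspace X" for \<sigma> q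
  proof (rule ccontr)
    assume "A \<sigma> q \<noteq> m"
    then have "m < A \<sigma> q"
      using min[of \<sigma> q] that by (simp add: m_def)
    then have "m < A t2 (\<eta>' p)"
      using that st min p \<eta>X
      by (intro strong_minimum[OF assms(3), of \<sigma> t2 m q]) (auto simp: m_def)
    then show False
      using end_min by simp
  qed
  have "A \<sigma> q = m" if "\<sigma> \<in> {t1..t2}" "q \<in> topspace X" for \<sigma> q
    using before[of \<sigma> q] before[of t1 "\<eta> q"] A_\<eta>[OF that(2)] \<eta>X that t12
    by (cases "\<sigma> = t2") auto
  then show ?thesis
    using constant_A_imp_flat[OF t12(2) st] by blast
qed

end
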